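(* Let $p\in(1,\infty)$ and let $\boldsymbol{\gamma}=(\gamma_j)_{j\ge 1}$ be a sequence of coordinate weights in $(0,1]$. A necessary condition for any notion of tractability (weak, polynomial, strong polynomial) of the $\boldsymbol{\gamma}$-weighted $L_p$-discrepancy is $\lim_{j\to\infty}\gamma_j=0$. In particular, the following hold. (i) If the $\boldsymbol{\gamma}$-weighted $L_p$-discrepancy is strongly polynomially tractable, then $\sum_{j=1}^{\infty}\gamma_j^{p/2}<\infty$. (ii) If the $\boldsymbol{\gamma}$-weighted $L_p$-discrepancy is polynomially tractable, then $\limsup_{d\to\infty}\frac{1}{\log d}\sum_{j=1}^d\gamma_j^{p/2}<\infty$. (iii) If the $\boldsymbol{\gamma}$-weighted $L_p$-discrepancy is weakly tractable, then $\lim_{d\to\infty}\frac{1}{d}\sum_{j=1}^d\gamma_j^{p/2}=0$.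
   Context: Notation: $\mathbb{N}=\{1,2,\ldots\}$, $[d]=\{1,\ldots,d\}$, and $\gamma_{\mathfrak{u}}=\prod_{j\in\mathfrak{u}}\gamma_j$ for $\mathfrak{u}\subseteq[d]$. For a set $\mathcal{P}=\{\boldsymbol{x}_1,\ldots,\boldsymbol{x}_N\}$ of $N$ points in $[0,1)^d$, the local discrepancy function is $$\Delta_{\mathcal{P}}(\boldsymbol{t})=\frac{|\{k\in\{1,\ldots,N\}:\boldsymbol{x}_k\in[0,t_1)\times\cdots\times[0,t_d)\}|}{N}-t_1t_2\cdots t_d,\qquad \boldsymbol{t}=(t_1,\ldots,t_d)\in[0,1]^d.$$ For $p\in[1,\infty)$ the weighted $L_p$-discrepancy of $\mathcal{P}$ is $$L_{p,\boldsymbol{\gamma},N}(\mathcal{P})=\Big(\sum_{\emptyset\ne\mathfrak{u}\subseteq[d]}\gamma_{\mathfrak{u}}^{p/2}\int_{[0,1]^{|\mathfrak{u}|}}|\Delta_{\mathcal{P}}((\boldsymbol{t}_{\mathfrak{u}},1))|^p\,\mathrm{d}\boldsymbol{t}_{\mathfrak{u}}\Big)^{1/p},$$ where $\boldsymbol{t}_{\mathfrak{u}}=(t_j)_{j\in\mathfrak{u}}$ and $(\boldsymbol{t}_{\mathfrak{u}},1)\in[0,1]^d$ has $j$-th coordinate $t_j$ if $j\in\mathfrak{u}$ and $1$ if $j\notin\mathfrak{u}$. For $N\in\mathbb{N}$ let $\mathrm{disc}_{p,\boldsymbol{\gamma}}(N,d)=\min_{\mathcal{P}}L_{p,\boldsymbol{\gamma},N}(\mathcal{P})$,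 the minimum (understood as an infimum) being over all $N$-element point sets in $[0,1)^d$. The initial discrepancy is $\mathrm{disc}_{p,\boldsymbol{\gamma}}(0,d)=\prod_{j=1}^d\big(1+\frac{\gamma_j^{p/2}}{p+1}\big)^{1/p}$. For $\varepsilon\in(0,1)$, $d\in\mathbb{N}$, put $$N^{\mathrm{disc}}_{p,\boldsymbol{\gamma}}(\varepsilon,d)=\min\{N\in\mathbb{N}:\mathrm{disc}_{p,\boldsymbol{\gamma}}(N,d)\le\varepsilon\,\mathrm{disc}_{p,\boldsymbol{\gamma}}(0,d)\}.$$ The $\boldsymbol{\gamma}$-weighted $L_p$-discrepancy is called - weakly tractable if $\lim_{d+\varepsilon^{-1}\to\infty}\frac{\log N^{\mathrm{disc}}_{p,\boldsymbol{\gamma}}(\varepsilon,d)}{d+\varepsilon^{-1}}=0$; - polynomially tractable if there are $C,\sigma>0$ and $\tau\ge0$ with $N^{\mathrm{disc}}_{p,\boldsymbol{\gamma}}(\varepsilon,d)\le C d^{\tau}\varepsilon^{-\sigma}$ for all $\varepsilon\in(0,1)$, $d\in\mathbb{N}$; - strongly polynomially tractable if there are $C,\sigma>0$ with $N^{\mathrm{disc}}_{p,\boldsymbol{\gamma}}(\varepsilon,d)\le C\varepsilon^{-\sigma}$ for all $\varepsilon\in(0,1)$, $d\in\mathbb{N}$.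
   Formalization: As stated, "lim γ_j = 0 is necessary" fails for weak and polynomial tractability (p=2, γ_j=1 at powers of 2, else 2^{-j}); there it is proved only when lim γ_j exists. For strong polynomial tractability it is unconditional. (i)–(iii) are as stated. *)

theory Defs
  imports "HOL-Analysis.Analysis"
begin

text \<open>
  Coordinates are indexed by \<open>{1..d}\<close>; the value \<open>\<gamma> 0\<close> of a weight sequence is never used.
  Points are extensional functions on \<open>{1..d}\<close>, so that cardinalities of point sets are correct.
\<close>

definition unit_cube :: "nat \<Rightarrow> (nat \<Rightarrow> real) set" where
  "unit_cube d = {1..d} \<rightarrow>\<^sub>E {0..<1}"

definition local_disc :: "nat \<Rightarrow> (nat \<Rightarrow> real) set \<Rightarrow> (nat \<Rightarrow> real) \<Rightarrow> real" where
  "local_disc d P t =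
     real (card {x \<in> P. \<forall>j\<in>{1..d}. x j \<in> {0..<t j}}) / real (card P) - (\<Prod>j=1..d. t j)"

definition fill_one :: "nat set \<Rightarrow> (nat \<Rightarrow> real) \<Rightarrow> nat \<Rightarrow> real" where
  "fill_one u t j = (if j \<in> u then t j else 1)"

definition weighted_Lp_disc ::
    "real \<Rightarrow> (nat \<Rightarrow> real) \<Rightarrow> nat \<Rightarrow> (nat \<Rightarrow> real) set \<Rightarrow> real" where
  "weighted_Lp_disc p \<gamma> d P =
     (\<Sum>u \<in> Pow {1..d} - {{}}.
        (\<Prod>j\<in>u. \<gamma> j) powr (p / 2) *
        set_lebesgue_integral (\<Pi>\<^sub>M j\<in>u. lborel) (\<Pi>\<^sub>E j\<in>u. {0..1})
          (\<lambda>t. \<bar>local_disc d P (fill_one u t)\<bar> powr p)) powr (1 / p)"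

definition disc :: "real \<Rightarrow> (nat \<Rightarrow> real) \<Rightarrow> nat \<Rightarrow> nat \<Rightarrow> real" where
  "disc p \<gamma> N d =
     (INF P \<in> {P. P \<subseteq> unit_cube d \<and> finite P \<and> card P = N}. weighted_Lp_disc p \<gamma> d P)"

definition initial_disc :: "real \<Rightarrow> (nat \<Rightarrow> real) \<Rightarrow> nat \<Rightarrow> real" where
  "initial_disc p \<gamma> d = (\<Prod>j=1..d. (1 + \<gamma> j powr (p / 2) / (p + 1)) powr (1 / p))"

text \<open>
  For \<open>1 \<le> p\<close>, \<open>1 \<le> d\<close> and \<open>0 < \<epsilon>\<close> some \<open>N\<close> satisfies the condition
  (regular grids have discrepancy tending to zero), so the minimum below exists.
\<close>

definition N_disc :: "real \<Rightarrow> (nat \<Rightarrow> real) \<Rightarrow> real \<Rightarrow> nat \<Rightarrow> nat" where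
  "N_disc p \<gamma> \<epsilon> d = (LEAST N. 1 \<le> N \<and> disc p \<gamma> N d \<le> \<epsilon> * initial_disc p \<gamma> d)"

text \<open>
  The filter expresses \<open>d + 1/\<epsilon> \<longrightarrow> \<infinity>\<close>, jointly over \<open>\<epsilon> \<in> (0,1)\<close> and \<open>d \<ge> 1\<close>.
\<close>

definition weakly_tractable :: "real \<Rightarrow> (nat \<Rightarrow> real) \<Rightarrow> bool" where
  "weakly_tractable p \<gamma> \<longleftrightarrow>
     ((\<lambda>(\<epsilon>, d). ln (real (N_disc p \<gamma> \<epsilon> d)) / (real d + 1 / \<epsilon>)) \<longlongrightarrow> 0)
       (inf (filtercomap (\<lambda>(\<epsilon>, d). real d + 1 / \<epsilon>) at_top)
            (principal ({0<..<1} \<times> {1..})))"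

definition polynomially_tractable :: "real \<Rightarrow> (nat \<Rightarrow> real) \<Rightarrow> bool" where
  "polynomially_tractable p \<gamma> \<longleftrightarrow>
     (\<exists>C \<sigma> \<tau>. C > 0 \<and> \<sigma> > 0 \<and> \<tau> \<ge> 0 \<and>
        (\<forall>\<epsilon>\<in>{0<..<1}. \<forall>d\<ge>1.
           real (N_disc p \<gamma> \<epsilon> d) \<le> C * real d powr \<tau> * \<epsilon> powr (- \<sigma>)))"

definition strongly_polynomially_tractable :: "real \<Rightarrow> (nat \<Rightarrow> real) \<Rightarrow> bool" where
  "strongly_polynomially_tractable p \<gamma> \<longleftrightarrow>
     (\<exists>C \<sigma>. C > 0 \<and> \<sigma> > 0 \<and>
        (\<forall>\<epsilon>\<in>{0<..<1}. \<forall>d\<ge>1. real (N_disc p \<gamma> \<epsilon> d) \<le> C * \<epsilon> powr (- \<sigma>)))"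

end

theory Submission
  imports Defs "HOL-Real_Asymp.Real_Asymp"
begin

text \<open>
  Up to the term \<open>u = {}\<close>, which vanishes, the \<open>p\<close>-th power of the discrepancy is the integral of
  \<open>\<bar>\<Delta>\<bar>\<^sup>p\<close> against the product of the measures \<open>\<delta>\<^sub>1 + w\<^sub>j dt\<close> with \<open>w\<^sub>j = \<gamma>\<^sub>j\<^sup>p\<^sup>/\<^sup>2\<close>, so \<open>\<Delta>\<close> can be tested
  against product functions by duality. Testing against \<open>\<Prod>\<^sub>j t\<^sub>j\<^sup>p\<^sup>-\<^sup>1\<close>, which is extremal for the initial
  discrepancy, shows that if the discrepancy is small then the points carry a fixed fraction of the
  integral of the extremal function \<open>h\<close>. On the other hand, for every single point \<open>x\<close> there is a
  product test function whose potential at \<open>x\<close> is at least \<open>h(x)\<close>, but whose integral and norm are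
  smaller than the extremal ones by a factor \<open>exp (- c (w\<^sub>1 + \<dots> + w\<^sub>d))\<close>; as all quadrature weights are
  positive, a single point carries at most that fraction. Hence at least
  \<open>exp (c (w\<^sub>1 + \<dots> + w\<^sub>d)) / 4\<close> points are needed to halve the initial discrepancy, and the
  claims follow by taking logarithms at \<open>\<epsilon> = 1/2\<close>.
\<close>

section \<open>The local discrepancy on faces of the cube: product form, integrability, pairing with
  product functions\<close>

lemma unit_cubeD:
  assumes "x \<in> unit_cube d" "j \<in> {1..d}"
  shows "0 \<le> x j" "x j < 1"
  using assms by (auto simp: unit_cube_def PiE_def Pi_def)

lemma prod_fill_one:
  assumes "u \<subseteq> {1..d}"
  shows "(\<Prod>j=1..d. fill_one u t j) = (\<Prod>j\<in>u. t j)"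
proof -
  have "(\<Prod>j=1..d. fill_one u t j) = (\<Prod>j\<in>u. fill_one u t j)"
    using assms by (intro prod.mono_neutral_right) (auto simp: fill_one_def)
  then show ?thesis by (simp add: fill_one_def)
qed

text \<open>A coordinate frozen at 1 imposes no condition on points of the half-open cube, so only
  the coordinates in \<open>u\<close> remain. The counting function thus becomes a sum of product
  functions; measurability and the factorization of integrals rest on this form.\<close>

lemma local_disc_fill_one:
  assumes "P \<subseteq> unit_cube d" "finite P" "u \<subseteq> {1..d}"
  shows "local_disc d P (fill_one u t) =
    (\<Sum>x\<in>P. \<Prod>j\<in>u. indicator {x j<..} (t j)) / real (card P) - (\<Prod>j\<in>u. t j)"
proof -
  have fu: "finite u" using assms(3) finite_subset by blast
  have "real (card {x \<in> P. \<forall>j\<in>{1..d}. x j \<in> {0..<fill_one u t j}})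
      = (\<Sum>x\<in>P. if \<forall>j\<in>{1..d}. x j \<in> {0..<fill_one u t j} then 1 else 0)"
    using assms(2) by (subst sum.If_cases) (auto simp: Int_def)
  also have "\<dots> = (\<Sum>x\<in>P. \<Prod>j\<in>u. indicator {x j<..} (t j))"
  proof (rule sum.cong[OF refl])
    fix x assume "x \<in> P"
    then have x: "0 \<le> x j" "x j < 1" if "j \<in> {1..d}" for j
      using unit_cubeD[of x d j] assms(1) that by auto
    have "(\<forall>j\<in>{1..d}. x j \<in> {0..<fill_one u t j}) \<longleftrightarrow> (\<forall>j\<in>u. x j < t j)"
      using x assms(3) by (auto simp: fill_one_def)
    moreover have "(\<Prod>j\<in>u. indicator {x j<..} (t j)) = (if \<forall>j\<in>u. x j < t j then 1 else (0::real))"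
    proof (cases "\<forall>j\<in>u. x j < t j")
      case True
      then show ?thesis by (auto intro!: prod.neutral)
    next
      case False
      then obtain j where "j \<in> u" "\<not> x j < t j" by blast
      then have "(\<Prod>j\<in>u. indicator {x j<..} (t j)) = (0::real)"
        using fu by (intro prod_zero bexI[of _ j]) auto
      with False show ?thesis by simp
    qed
    ultimately show "(if \<forall>j\<in>{1..d}. x j \<in> {0..<fill_one u t j} then 1 else 0)
      = (\<Prod>j\<in>u. indicator {x j<..} (t j) :: real)" by simp
  qed
  finally show ?thesis
    unfolding local_disc_def prod_fill_one[OF assms(3)] by simp
qed

text \<open>The discrepancy is a difference of two numbers in \<open>[0,1]\<close>. This serves to
  make its p-th power integrable over the unit box.\<close>

lemma local_disc_bounded:
  assumes "P \<subseteq> unit_cube d" "finite P" "u \<subseteq> {1..d}" "\<And>j. j \<in> u \<Longrightarrow> t j \<in> {0..1}"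
  shows "\<bar>local_disc d P (fill_one u t)\<bar> \<le> 1"
proof -
  have "real (card {x \<in> P. \<forall>j\<in>{1..d}. x j \<in> {0..<fill_one u t j}}) / real (card P) \<le> 1"
    using assms(2) by (auto intro!: divide_le_eq_1[THEN iffD2] card_mono simp: card_gt_0_iff)
  moreover have "0 \<le> real (card {x \<in> P. \<forall>j\<in>{1..d}. x j \<in> {0..<fill_one u t j}}) / real (card P)"
    by simp
  moreover have "0 \<le> (\<Prod>j\<in>u. t j)" "(\<Prod>j\<in>u. t j) \<le> 1"
    using assms(4) by (auto intro!: prod_nonneg prod_le_1)
  ultimately show ?thesis
    unfolding local_disc_def prod_fill_one[OF assms(3)] by linarith
qed

lemma integrable_bounded_support:
  fixes f :: "real \<Rightarrow> real"
  assumes "f \<in> borel_measurable borel" "\<And>t. \<bar>f t\<bar> \<le> B" "\<And>t. t \<notin> {0..1} \<Longrightarrow> f t = 0"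
  shows "integrable lborel f"
proof (rule integrableI_bounded_set[where A="{0..1}" and B=B])
  show "AE x in lborel. x \<in> {0..1} \<longrightarrow> norm (f x) \<le> B" using assms(2) by simp
qed (use assms in auto)

interpretation lborel_prod: product_sigma_finite "\<lambda>_::nat. lborel :: real measure"
  by (rule product_sigma_finite.intro) (rule sigma_finite_lborel)

lemma indicator_PiE_prod:
  assumes "finite u" "t \<in> extensional u"
  shows "indicator (Pi\<^sub>E u A) t = (\<Prod>j\<in>u. indicator (A j) (t j) :: real)"
proof (cases "\<forall>j\<in>u. t j \<in> A j")
  case True
  then show ?thesis using assms by (auto simp: PiE_def Pi_def)
next
  case False
  then show ?thesis using assms by (auto simp: indicator_def)
qed

lemma space_PiM_extensional:
  "t \<in> space (\<Pi>\<^sub>M j\<in>u. (lborel :: real measure)) \<longleftrightarrow> t \<in> extensional u"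
  by (simp add: space_PiM PiE_UNIV_domain) (simp add: PiE_def)

text \<open>The indicator of the box is a product of one-dimensional indicators, so its integral
  factorizes. It later serves as the dominating function for bounded integrands on the box.\<close>

lemma unit_box_integrable:
  assumes "finite u"
  shows "integrable (\<Pi>\<^sub>M j\<in>u. (lborel :: real measure))
    (indicator (\<Pi>\<^sub>E (j::nat)\<in>u. {0..1}) :: _ \<Rightarrow> real)"
    and "integral\<^sup>L (\<Pi>\<^sub>M j\<in>u. (lborel :: real measure))
    (indicator (\<Pi>\<^sub>E (j::nat)\<in>u. {0..1}) :: _ \<Rightarrow> real) = 1"
proof -
  let ?M = "\<Pi>\<^sub>M j\<in>u. (lborel :: real measure)"
  have eq: "(indicator (\<Pi>\<^sub>E j\<in>u. {0..1}) t :: real) = (\<Prod>j\<in>u. indicator {0..1} (t j))"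
    if "t \<in> space ?M" for t
    using that assms by (simp add: space_PiM_extensional indicator_PiE_prod)
  have i: "integrable lborel (indicator {0..1::real} :: real \<Rightarrow> real)" by simp
  show "integrable ?M (indicator (\<Pi>\<^sub>E j\<in>u. {0..1}) :: _ \<Rightarrow> real)"
    using lborel_prod.product_integrable_prod[OF assms, of "\<lambda>_. indicator {0..1}", OF i]
    by (subst Bochner_Integration.integrable_cong[OF refl eq]) auto
  show "integral\<^sup>L ?M (indicator (\<Pi>\<^sub>E j\<in>u. {0..1}) :: _ \<Rightarrow> real) = 1"
    using lborel_prod.product_integral_prod[OF assms, of "\<lambda>_. indicator {0..1}", OF i]
    by (subst Bochner_Integration.integral_cong[OF refl eq]) auto
qed

lemma local_disc_measurable:
  assumes "P \<subseteq> unit_cube d" "finite P" "u \<subseteq> {1..d}"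
  shows "(\<lambda>t. local_disc d P (fill_one u t)) \<in> borel_measurable (\<Pi>\<^sub>M j\<in>u. lborel)"
  unfolding local_disc_fill_one[OF assms] by measurable

lemma local_disc_powr_integrable:
  assumes "P \<subseteq> unit_cube d" "finite P" "u \<subseteq> {1..d}" "0 \<le> p"
  shows "set_integrable (\<Pi>\<^sub>M j\<in>u. lborel) (\<Pi>\<^sub>E j\<in>u. {0..1})
    (\<lambda>t. \<bar>local_disc d P (fill_one u t)\<bar> powr p)"
proof -
  have fu: "finite u" using assms(3) finite_subset by blast
  have m: "(\<lambda>t. local_disc d P (fill_one u t)) \<in> borel_measurable (\<Pi>\<^sub>M j\<in>u. lborel)"
    by (rule local_disc_measurable) (use assms in auto)
  have i: "(indicator (\<Pi>\<^sub>E (j::nat)\<in>u. {0..1::real}) :: _ \<Rightarrow> real) \<in> borel_measurable (\<Pi>\<^sub>M j\<in>u. lborel)"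
    by (rule borel_measurable_integrable[OF unit_box_integrable(1)[OF fu]])
  show ?thesis
    unfolding set_integrable_def
  proof (rule Bochner_Integration.integrable_bound[OF unit_box_integrable(1)[OF fu]])
    show "(\<lambda>t. indicat_real (\<Pi>\<^sub>E j\<in>u. {0..1}) t *\<^sub>R \<bar>local_disc d P (fill_one u t)\<bar> powr p)
      \<in> borel_measurable (\<Pi>\<^sub>M j\<in>u. lborel)"
      using m i by measurable
    have "\<bar>local_disc d P (fill_one u t)\<bar> powr p \<le> 1" if "t \<in> (\<Pi>\<^sub>E j\<in>u. {0..1})" for t
      using local_disc_bounded[OF assms(1-3), of t] that assms(4) by (auto simp: PiE_def Pi_def powr_le1)
    then show "AE t in \<Pi>\<^sub>M j\<in>u. lborel. norm (indicat_real (\<Pi>\<^sub>E j\<in>u. {0..1}) t *\<^sub>R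
        \<bar>local_disc d P (fill_one u t)\<bar> powr p) \<le> norm (indicat_real (\<Pi>\<^sub>E j\<in>u. {0..1}) t)"
      by (intro AE_I2) (auto simp: indicator_def)
  qed
qed

text \<open>Each summand of the discrepancy is a product over the coordinates, so its integral
  against a product function factorizes. The value is the error of the equal-weight quadrature at
  \<open>P\<close> for the product of the potentials that send \<open>y\<close> to the integral of
  \<open>\<phi> j\<close> over \<open>t > y\<close>; by Fubini the integral of such a potential over
  the unit interval is that of \<open>\<phi> j t * t\<close>.\<close>

lemma integral_prod_local_disc:
  fixes \<phi> :: "nat \<Rightarrow> real \<Rightarrow> real"
  assumes P: "P \<subseteq> unit_cube d" "finite P" and u: "u \<subseteq> {1..d}"
    and \<phi>: "\<And>j. \<phi> j \<in> borel_measurable borel" "\<And>j t. \<bar>\<phi> j t\<bar> \<le> B"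
      "\<And>j t. t \<notin> {0..1} \<Longrightarrow> \<phi> j t = 0"
  shows "has_bochner_integral (\<Pi>\<^sub>M j\<in>u. lborel) (\<lambda>t. (\<Prod>j\<in>u. \<phi> j (t j)) * local_disc d P (fill_one u t))
     ((\<Sum>x\<in>P. \<Prod>j\<in>u. \<integral>t. \<phi> j t * indicator {x j<..} t \<partial>lborel) / real (card P) -
      (\<Prod>j\<in>u. \<integral>t. \<phi> j t * t \<partial>lborel))"
proof -
  have fu: "finite u" using u finite_subset by blast
  have B: "0 \<le> B" using \<phi>(2)[of 0 0] by linarith
  have i1: "integrable lborel (\<lambda>t. \<phi> j t * indicator {c<..} t)" for j c
    by (rule integrable_bounded_support[where B=B]) (use \<phi> B in \<open>auto simp: indicator_def\<close>)
  have i2: "integrable lborel (\<lambda>t. \<phi> j t * t)" for j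
  proof (rule integrable_bounded_support[where B=B])
    show "\<bar>\<phi> j t * t\<bar> \<le> B" for t
    proof (cases "t \<in> {0..1}")
      case True
      then have "\<bar>\<phi> j t\<bar> * \<bar>t\<bar> \<le> B * 1" using \<phi>(2) B by (intro mult_mono) auto
      then show ?thesis by (simp add: abs_mult)
    qed (use \<phi> B in auto)
  qed (use \<phi> in auto)
  have h: "has_bochner_integral (\<Pi>\<^sub>M j\<in>u. lborel) (\<lambda>t. \<Prod>j\<in>u. f j (t j)) (\<Prod>j\<in>u. integral\<^sup>L lborel (f j))"
    if "\<And>j. integrable lborel (f j)" for f :: "nat \<Rightarrow> real \<Rightarrow> real"
    using lborel_prod.product_integrable_prod[OF fu, of f] lborel_prod.product_integral_prod[OF fu, of f] that
    by (simp add: has_bochner_integral_iff)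
  have "has_bochner_integral (\<Pi>\<^sub>M j\<in>u. lborel)
    (\<lambda>t. (\<Sum>x\<in>P. \<Prod>j\<in>u. \<phi> j (t j) * indicator {x j<..} (t j)) / real (card P) - (\<Prod>j\<in>u. \<phi> j (t j) * t j))
     ((\<Sum>x\<in>P. \<Prod>j\<in>u. \<integral>t. \<phi> j t * indicator {x j<..} t \<partial>lborel) / real (card P) -
      (\<Prod>j\<in>u. \<integral>t. \<phi> j t * t \<partial>lborel))"
    by (intro has_bochner_integral_diff has_bochner_integral_divide_zero has_bochner_integral_sum h
          h[where f="\<lambda>j t. \<phi> j t * t"] i1 i2)
  then show ?thesis
    by (rule has_bochner_integral_cong[THEN iffD1, rotated -1])
       (auto simp: local_disc_fill_one[OF P u] prod.distrib sum_distrib_left algebra_simps)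
qed

section \<open>Duality: Hoelder's inequality for the sum over all faces\<close>

text \<open>Multiplying out picks for every coordinate either 1 (the coordinate is frozen at 1) or
  \<open>f j\<close> (it is integrated). This turns sums over faces into products over
  coordinates.\<close>

lemma sum_Pow_prod:
  fixes f :: "'a \<Rightarrow> 'b::comm_semiring_1"
  assumes "finite A"
  shows "(\<Sum>u\<in>Pow A. \<Prod>j\<in>u. f j) = (\<Prod>j\<in>A. 1 + f j)"
  using prod_add[OF assms, of f "\<lambda>_. 1"] by (simp add: add.commute)

text \<open>The empty face may be added to the sum: at the corner \<open>(1,...,1)\<close> every
  point is counted, so the discrepancy of a nonempty \<open>P\<close> vanishes there. With all
  subsets present the sum has the form of an expanded product.\<close>

lemma weighted_Lp_disc_powr:
  assumes "P \<subseteq> unit_cube d" "finite P" "P \<noteq> {}" "0 < p" "\<And>j. j \<in> {1..d} \<Longrightarrow> 0 \<le> \<gamma> j"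
  shows "weighted_Lp_disc p \<gamma> d P powr p =
    (\<Sum>u\<in>Pow {1..d}. (\<Prod>j\<in>u. \<gamma> j powr (p / 2)) *
        set_lebesgue_integral (\<Pi>\<^sub>M j\<in>u. lborel) (\<Pi>\<^sub>E j\<in>u. {0..1})
          (\<lambda>t. \<bar>local_disc d P (fill_one u t)\<bar> powr p))"
    (is "_ = (\<Sum>u\<in>_. ?w u * ?I u)")
proof -
  have "card P \<noteq> 0" using assms by auto
  then have "local_disc d P (fill_one {} t) = 0" for t
    using local_disc_fill_one[of P d "{}" t] assms by simp
  then have "?I {} = 0" by (simp add: set_lebesgue_integral_def)
  have "(\<Sum>u\<in>Pow {1..d}. ?w u * ?I u) = (\<Sum>u\<in>Pow {1..d} - {{}}. ?w u * ?I u)"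
    by (rule sum.mono_neutral_right) (use \<open>?I {} = 0\<close> in auto)
  also have "\<dots> = (\<Sum>u\<in>Pow {1..d} - {{}}. (\<Prod>j\<in>u. \<gamma> j) powr (p / 2) * ?I u)"
    by (simp add: prod_powr_distrib)
  also have "\<dots> = weighted_Lp_disc p \<gamma> d P powr p"
  proof -
    have "0 \<le> (\<Sum>u\<in>Pow {1..d} - {{}}. (\<Prod>j\<in>u. \<gamma> j) powr (p / 2) * ?I u)"
      by (intro sum_nonneg mult_nonneg_nonneg)
        (auto simp: set_lebesgue_integral_def intro!: Bochner_Integration.integral_nonneg)
    then show ?thesis using assms(4) by (simp add: weighted_Lp_disc_def powr_powr)
  qed
  finally show ?thesis by simp
qed

text \<open>
  Hoelder's inequality for the product measure with factors \<open>\<delta>\<^sub>1 + \<gamma>\<^sub>j\<^sup>p\<^sup>/\<^sup>2 dt\<close>.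
\<close>

lemma product_test_function_bound:
  fixes \<phi> :: "nat \<Rightarrow> real \<Rightarrow> real" and p q M :: real
  defines "H \<equiv> \<lambda>j y. \<integral>t. \<phi> j t * indicator {y<..} t \<partial>lborel"
  assumes pq: "1 < p" "1 < q" "1 / p + 1 / q = 1"
    and P: "P \<subseteq> unit_cube d" "finite P" "P \<noteq> {}"
    and \<gamma>: "\<And>j. j \<in> {1..d} \<Longrightarrow> 0 \<le> \<gamma> j"
    and \<phi>: "\<And>j. \<phi> j \<in> borel_measurable borel" "\<And>j t. 0 \<le> \<phi> j t" "\<And>j t. \<phi> j t \<le> B"
      "\<And>j t. t \<notin> {0..1} \<Longrightarrow> \<phi> j t = 0"
    and M: "0 < M" "weighted_Lp_disc p \<gamma> d P \<le> M"
  shows "\<bar>(\<Sum>x\<in>P. \<Prod>j=1..d. 1 + \<gamma> j powr (p/2) * H j (x j)) / real (card P)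
      - (\<Prod>j=1..d. 1 + \<gamma> j powr (p/2) * (\<integral>t. \<phi> j t * t \<partial>lborel))\<bar>
    \<le> M * (\<Prod>j=1..d. 1 + \<gamma> j powr (p/2) * (\<integral>t. \<phi> j t powr q \<partial>lborel)) powr (1 / q)"
    (is "\<bar>?L\<bar> \<le> M * ?G powr (1/q)")
proof -
  define w where "w u = (\<Prod>j\<in>u. \<gamma> j powr (p/2))" for u
  define D where "D u = (\<Sum>x\<in>P. \<Prod>j\<in>u. H j (x j)) / real (card P)
      - (\<Prod>j\<in>u. \<integral>t. \<phi> j t * t \<partial>lborel)" for u
  define A where "A u = (LINT t:(\<Pi>\<^sub>E j\<in>u. {0..1})|(\<Pi>\<^sub>M j\<in>u. lborel).
      \<bar>local_disc d P (fill_one u t)\<bar> powr p)" for u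
  define E where "E u = (\<Prod>j\<in>u. \<integral>t. \<phi> j t powr q \<partial>lborel)" for u
  \<comment> \<open>\<open>K\<close> is the q-norm of the test function for the measure with factors
    point mass at 1 plus weighted Lebesgue measure; \<open>M\<close> bounds the p-norm of the
    discrepancy. They are the two normalizing constants in the usual derivation of Hoelder's
    inequality from Young's.\<close>
  define K where "K = ?G powr (1 / q)"
  have w: "0 \<le> w u" for u by (simp add: w_def prod_nonneg)
  have B: "0 \<le> B" using \<phi>(2)[of 0 0] \<phi>(3)[of 0 0] by linarith
  have "1 \<le> ?G"
    by (intro prod_ge_1) (auto intro!: mult_nonneg_nonneg Bochner_Integration.integral_nonneg)
  moreover have "0 < g powr (1 / q) \<and> (g powr (1 / q)) powr q = g" if "1 \<le> g" for g :: real
    using that pq by (simp add: powr_powr)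
  ultimately have K: "0 < K" "K powr q = ?G"
    unfolding K_def by blast+
  have wD: "(\<Sum>u\<in>Pow {1..d}. w u * D u) = ?L"
  proof -
    have "(\<Sum>u\<in>Pow {1..d}. w u * D u) =
      (\<Sum>u\<in>Pow {1..d}. \<Sum>x\<in>P. (\<Prod>j\<in>u. \<gamma> j powr (p/2) * H j (x j))) / real (card P)
      - (\<Sum>u\<in>Pow {1..d}. \<Prod>j\<in>u. \<gamma> j powr (p/2) * (\<integral>t. \<phi> j t * t \<partial>lborel))"
      by (simp add: D_def w_def prod.distrib right_diff_distrib sum_subtractf sum_distrib_left
          sum_divide_distrib)
    also have "\<dots> = ?L"
      by (subst sum.swap) (simp add: sum_Pow_prod)
    finally show ?thesis .
  qed
  have wE: "(\<Sum>u\<in>Pow {1..d}. w u * E u) = ?G"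
    by (simp add: w_def E_def sum_Pow_prod flip: prod.distrib)
  have Gq: "(\<Sum>u\<in>Pow {1..d}. w u * E u) / K powr q = 1"
    unfolding wE K(2) by (rule divide_self) (use \<open>1 \<le> ?G\<close> in linarith)
  have wA: "(\<Sum>u\<in>Pow {1..d}. w u * A u) \<le> M powr p"
  proof -
    have "(\<Sum>u\<in>Pow {1..d}. w u * A u) = weighted_Lp_disc p \<gamma> d P powr p"
      using weighted_Lp_disc_powr[of P d p \<gamma>] P pq \<gamma> by (simp add: w_def A_def)
    also have "\<dots> \<le> M powr p"
      using M pq by (intro powr_mono2) (auto simp: weighted_Lp_disc_def)
    finally show ?thesis .
  qed
  \<comment> \<open>Young's inequality is applied pointwise to the discrepancy divided by
    \<open>M\<close> and the test function divided by \<open>K\<close>, then integrated over one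
    face. Summed with the weights \<open>w u\<close>, the \<open>A\<close>-terms total at most 1 and
    the \<open>E\<close>-terms exactly 1, which leaves \<open>1 / p + 1 / q = 1\<close>.\<close>
  have young: "\<bar>D u\<bar> \<le> M * K * (A u / M powr p / p + E u / K powr q / q)" if u: "u \<in> Pow {1..d}" for u
  proof -
    let ?M = "\<Pi>\<^sub>M j\<in>u. (lborel :: real measure)"
    let ?\<Delta> = "\<lambda>t. local_disc d P (fill_one u t)"
    have fu: "finite u" using u finite_subset by blast
    have hD: "has_bochner_integral ?M (\<lambda>t. (\<Prod>j\<in>u. \<phi> j (t j)) * ?\<Delta> t) (D u)"
      unfolding D_def H_def
      by (rule integral_prod_local_disc[where B=B]) (use P u \<phi> in auto)
    have hA: "has_bochner_integral ?M
        (\<lambda>t. indicator (\<Pi>\<^sub>E j\<in>u. {0..1}) t * \<bar>?\<Delta> t\<bar> powr p) (A u)"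
      using local_disc_powr_integrable[of P d u p] P u pq
      by (simp add: has_bochner_integral_iff A_def set_lebesgue_integral_def set_integrable_def)
    have iq: "integrable lborel (\<lambda>t. \<phi> j t powr q)" for j
      by (rule integrable_bounded_support[where B="B powr q"])
        (use \<phi> pq in \<open>auto intro!: powr_mono2\<close>)
    have hE: "has_bochner_integral ?M (\<lambda>t. \<Prod>j\<in>u. \<phi> j (t j) powr q) (E u)"
      using lborel_prod.product_integrable_prod[OF fu iq] lborel_prod.product_integral_prod[OF fu iq]
      by (simp add: has_bochner_integral_iff E_def)
    have "\<bar>D u\<bar> = norm (\<integral>t. (\<Prod>j\<in>u. \<phi> j (t j)) * ?\<Delta> t \<partial>?M)"
      using has_bochner_integral_integral_eq[OF hD] by simp
    also have "\<dots> \<le> (\<integral>t. norm ((\<Prod>j\<in>u. \<phi> j (t j)) * ?\<Delta> t) \<partial>?M)"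
      by (rule Bochner_Integration.integral_norm_bound)
    also have "\<dots> \<le> (\<integral>t. M * K * (indicator (\<Pi>\<^sub>E j\<in>u. {0..1}) t * \<bar>?\<Delta> t\<bar> powr p / M powr p / p
        + (\<Prod>j\<in>u. \<phi> j (t j) powr q) / K powr q / q) \<partial>?M)"
    proof (rule Bochner_Integration.integral_mono)
      show "integrable ?M (\<lambda>t. norm ((\<Prod>j\<in>u. \<phi> j (t j)) * ?\<Delta> t))"
        using hD by (intro integrable_norm) (auto simp: has_bochner_integral_iff)
      show "integrable ?M (\<lambda>t. M * K * (indicator (\<Pi>\<^sub>E j\<in>u. {0..1}) t * \<bar>?\<Delta> t\<bar> powr p / M powr p / p
          + (\<Prod>j\<in>u. \<phi> j (t j) powr q) / K powr q / q))"
        using hA hE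
        by (intro integrable_mult_right Bochner_Integration.integrable_add integrable_divide)
          (auto simp: has_bochner_integral_iff)
    next
      fix t assume "t \<in> space ?M"
      then have t: "t \<in> extensional u" by (simp add: space_PiM_extensional)
      have g: "0 \<le> (\<Prod>j\<in>u. \<phi> j (t j))" using \<phi> by (simp add: prod_nonneg)
      show "norm ((\<Prod>j\<in>u. \<phi> j (t j)) * ?\<Delta> t)
        \<le> M * K * (indicator (\<Pi>\<^sub>E j\<in>u. {0..1}) t * \<bar>?\<Delta> t\<bar> powr p / M powr p / p
        + (\<Prod>j\<in>u. \<phi> j (t j) powr q) / K powr q / q)"
      proof (cases "\<forall>j\<in>u. t j \<in> {0..1}")
        case True
        then have ind: "t \<in> (\<Pi>\<^sub>E j\<in>u. {0..1})" using t by (auto simp: PiE_def)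
        have "\<bar>?\<Delta> t\<bar> / M * ((\<Prod>j\<in>u. \<phi> j (t j)) / K)
          \<le> (\<bar>?\<Delta> t\<bar> / M) powr p / p + ((\<Prod>j\<in>u. \<phi> j (t j)) / K) powr q / q"
          using pq M K g by (intro Youngs_inequality) auto
        then have "M * K * (\<bar>?\<Delta> t\<bar> / M * ((\<Prod>j\<in>u. \<phi> j (t j)) / K))
          \<le> M * K * ((\<bar>?\<Delta> t\<bar> / M) powr p / p + ((\<Prod>j\<in>u. \<phi> j (t j)) / K) powr q / q)"
          using M K by (intro mult_left_mono) auto
        moreover have "norm ((\<Prod>j\<in>u. \<phi> j (t j)) * ?\<Delta> t)
            = M * K * (\<bar>?\<Delta> t\<bar> / M * ((\<Prod>j\<in>u. \<phi> j (t j)) / K))"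
          using M K g by (simp add: abs_mult)
        ultimately show ?thesis
          using ind M K g by (simp add: powr_divide prod_powr_distrib)
      next
        case False
        then have "(\<Prod>j\<in>u. \<phi> j (t j)) = 0" using fu \<phi>(4) by (auto intro!: prod_zero)
        then have "norm ((\<Prod>j\<in>u. \<phi> j (t j)) * ?\<Delta> t) = 0" by simp
        also have "0 \<le> M * K * (indicator (\<Pi>\<^sub>E j\<in>u. {0..1}) t * \<bar>?\<Delta> t\<bar> powr p / M powr p / p
          + (\<Prod>j\<in>u. \<phi> j (t j) powr q) / K powr q / q)"
          using M K(1) pq by (intro mult_nonneg_nonneg add_nonneg_nonneg divide_nonneg_nonneg prod_nonneg) auto
        finally show ?thesis .
      qed
    qed
    also have "\<dots> = M * K * (A u / M powr p / p + E u / K powr q / q)"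
      by (rule has_bochner_integral_integral_eq)
        (intro has_bochner_integral_mult_right has_bochner_integral_add has_bochner_integral_divide_zero hA hE)
    finally show ?thesis .
  qed
  have "\<bar>?L\<bar> \<le> (\<Sum>u\<in>Pow {1..d}. w u * \<bar>D u\<bar>)"
    unfolding wD[symmetric] by (rule order.trans[OF sum_abs]) (simp add: abs_mult w)
  also have "\<dots> \<le> (\<Sum>u\<in>Pow {1..d}. w u * (M * K * (A u / M powr p / p + E u / K powr q / q)))"
    by (intro sum_mono mult_left_mono young w)
  also have "\<dots> = M * K * ((\<Sum>u\<in>Pow {1..d}. w u * A u) / M powr p / p
      + (\<Sum>u\<in>Pow {1..d}. w u * E u) / K powr q / q)"
    by (simp add: sum_distrib_left sum_divide_distrib sum.distrib algebra_simps)
  also have "\<dots> \<le> M * K * (1 / p + 1 / q)"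
    using wA Gq K(1) M pq by (intro mult_left_mono add_mono divide_right_mono) auto
  finally show ?thesis using pq by (simp add: K_def)
qed


section \<open>One-dimensional test functions: truncated powers and fooling functions\<close>

lemma powr_integral_from_0:
  fixes a c :: real
  assumes "0 \<le> a" "0 \<le> c" "c \<le> 1"
  shows "has_bochner_integral lborel (\<lambda>t. t powr a * indicator {0<..c} t) (c powr (a + 1) / (a + 1))"
proof -
  let ?f = "\<lambda>t::real. t powr a * indicator {0<..c} t"
  have i: "integrable lborel ?f"
    by (rule integrable_bounded_support[where B=1])
      (use assms in \<open>auto simp: indicator_def powr_le1\<close>)
  have "((\<lambda>t. t powr a) has_integral (c powr (a + 1) / (a + 1))) {0..c}"
    using has_integral_powr_from_0[of a c] assms by simp
  then have "((\<lambda>t. if t \<in> {0..c} then t powr a else 0) has_integral (c powr (a + 1) / (a + 1))) UNIV"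
    by (subst has_integral_restrict_UNIV)
  then have "(?f has_integral (c powr (a + 1) / (a + 1))) UNIV"
    by (rule has_integral_spike_finite[of "{0}", rotated -1]) (auto simp: indicator_def)
  then show ?thesis
    using has_integral_integral_lborel[OF i] i has_integral_unique
    by (auto simp: has_bochner_integral_iff)
qed

lemma powr_integral:
  fixes a y :: real
  assumes "0 \<le> a" "0 \<le> y" "y \<le> 1"
  shows "has_bochner_integral lborel (\<lambda>t. t powr a * indicator {y<..1} t) ((1 - y powr (a + 1)) / (a + 1))"
proof -
  have "has_bochner_integral lborel (\<lambda>t. t powr a * indicator {0<..1} t - t powr a * indicator {0<..y} t)
      (1 powr (a + 1) / (a + 1) - y powr (a + 1) / (a + 1))"
    by (intro has_bochner_integral_diff powr_integral_from_0) (use assms in auto)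
  then show ?thesis
    by (rule has_bochner_integral_cong[THEN iffD1, rotated -1])
      (use assms in \<open>auto simp: indicator_def diff_divide_distrib\<close>)
qed

text \<open>For \<open>a = p - 1\<close> and \<open>y = 0\<close> this is the extremal function of
  the initial discrepancy: on the unit interval \<open>t powr (p - 1)\<close> is dual to
  \<open>t\<close> in Hoelder's inequality. Positive \<open>y\<close> gives its truncations.\<close>

definition cutoff_power :: "real \<Rightarrow> real \<Rightarrow> real \<Rightarrow> real" where
  "cutoff_power a y t = t powr a * indicator {y<..1} t"

lemma cutoff_power_measurable [measurable]: "cutoff_power a y \<in> borel_measurable borel"
  unfolding cutoff_power_def by measurable

lemma cutoff_power_bounds:
  assumes "0 \<le> a" "0 \<le> y"
  shows "0 \<le> cutoff_power a y t" "cutoff_power a y t \<le> 1" "t \<notin> {0..1} \<Longrightarrow> cutoff_power a y t = 0"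
  using assms by (auto simp: cutoff_power_def indicator_def powr_le1)

text \<open>Since \<open>(p - 1) * q = p\<close>, both \<open>\<phi> t * t\<close> and
  \<open>\<phi> t powr q\<close> reduce to \<open>t powr p\<close> on the support. The last two
  integrals therefore agree, as they must in the equality case of Hoelder's inequality.\<close>

lemma cutoff_power_integrals:
  assumes "1 < p" "0 \<le> y" "y \<le> 1" "0 \<le> z" "z \<le> 1" "q = p / (p - 1)"
  shows "(\<integral>t. cutoff_power (p - 1) y t * indicator {z<..} t \<partial>lborel) = (1 - max y z powr p) / p"
    and "(\<integral>t. cutoff_power (p - 1) y t * t \<partial>lborel) = (1 - y powr (p + 1)) / (p + 1)"
    and "(\<integral>t. cutoff_power (p - 1) y t powr q \<partial>lborel) = (1 - y powr (p + 1)) / (p + 1)"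
proof -
  have "cutoff_power (p - 1) y t * indicator {z<..} t = t powr (p - 1) * indicator {max y z<..1} t" for t
    by (auto simp: cutoff_power_def indicator_def)
  then show "(\<integral>t. cutoff_power (p - 1) y t * indicator {z<..} t \<partial>lborel) = (1 - max y z powr p) / p"
    using has_bochner_integral_integral_eq[OF powr_integral[of "p - 1" "max y z"]] assms by simp
  have "cutoff_power (p - 1) y t * t = t powr p * indicator {y<..1} t" for t
    using assms powr_mult_base[of t "p - 1"] by (auto simp: cutoff_power_def indicator_def mult.commute)
  then show "(\<integral>t. cutoff_power (p - 1) y t * t \<partial>lborel) = (1 - y powr (p + 1)) / (p + 1)"
    using has_bochner_integral_integral_eq[OF powr_integral[of p y]] assms by simp
  have "cutoff_power (p - 1) y t powr q = t powr p * indicator {y<..1} t" for t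
    using assms by (auto simp: cutoff_power_def indicator_def powr_powr)
  then show "(\<integral>t. cutoff_power (p - 1) y t powr q \<partial>lborel) = (1 - y powr (p + 1)) / (p + 1)"
    using has_bochner_integral_integral_eq[OF powr_integral[of p y]] assms by simp
qed

text \<open>This is strict Jensen: \<open>t powr (p - 1)\<close> has mean \<open>1 / p\<close> and
  q-th moment \<open>1 / (p + 1)\<close> on the unit interval, and the constant with the same mean
  has a smaller q-th moment. The computation needs only \<open>ln p > 1 - 1 / p\<close> and
  \<open>exp x \<ge> 1 + x\<close>.\<close>

lemma inverse_powr_conjugate_less:
  fixes p :: real
  assumes "1 < p"
  shows "(1 / p) powr (p / (p - 1)) < 1 / (p + 1)"
proof -
  have "ln (1 / p) < 1 / p - 1"
    using ln_le_minus_one[of "1 / p"] ln_eq_minus_one[of "1 / p"] assms by fastforce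
  then have "1 - 1 / p < ln p" using assms by (simp add: ln_div)
  then have "(1 - 1 / p) / (p - 1) < ln p / (p - 1)"
    using assms by (intro divide_strict_right_mono) auto
  moreover have "(1 - 1 / p) / (p - 1) = 1 / p" using assms by (simp add: divide_simps)
  ultimately have "1 + 1 / p < 1 + ln p / (p - 1)" by simp
  also have "\<dots> \<le> exp (ln p / (p - 1))" by (rule exp_ge_add_one_self)
  also have "\<dots> = p powr (1 / (p - 1))" using assms by (simp add: powr_def)
  finally have "p * (1 + 1 / p) < p * p powr (1 / (p - 1))" using assms by simp
  also have "\<dots> = p powr (1 + 1 / (p - 1))" using assms by (simp add: powr_add)
  also have "1 + 1 / (p - 1) = p / (p - 1)" using assms by (simp add: field_simps)
  finally have "p + 1 < p powr (p / (p - 1))" using assms by (simp add: distrib_left)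
  then show ?thesis using assms by (simp add: powr_divide frac_less2)
qed

text \<open>
  Away from \<open>y = 0\<close> one truncates \<open>t\<^sup>p\<^sup>-\<^sup>1\<close> to \<open>t > y\<close>; near \<open>y = 0\<close> one uses a constant slightly
  above its mean \<open>1 / p\<close>, which is where \<open>p > 1\<close> enters.
\<close>

definition fooling_function ::
    "real \<Rightarrow> real \<Rightarrow> real \<Rightarrow> real \<Rightarrow> real \<Rightarrow> (real \<Rightarrow> real) \<Rightarrow> bool" where
  "fooling_function p q \<theta> B y \<phi> \<longleftrightarrow>
     \<phi> \<in> borel_measurable borel \<and> (\<forall>t. 0 \<le> \<phi> t \<and> \<phi> t \<le> B \<and> (t \<notin> {0..1} \<longrightarrow> \<phi> t = 0)) \<and>
     (1 - y powr p) / p \<le> (\<integral>t. \<phi> t * indicator {y<..} t \<partial>lborel) \<and>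
     (\<integral>t. \<phi> t * t \<partial>lborel) \<le> \<theta> \<and> (\<integral>t. \<phi> t powr q \<partial>lborel) \<le> \<theta>"

text \<open>The point is that one \<open>\<theta>\<close> below the extremal value
  \<open>1 / (p + 1)\<close> serves all \<open>y\<close>. Truncation alone gains nothing as
  \<open>y\<close> tends to 0, and a constant cannot serve up to \<open>y = 1\<close> with a bounded
  height that stays cheap; a threshold \<open>a\<close> separates the two regimes.\<close>

lemma exists_fooling_functions:
  fixes p q :: real
  assumes p: "1 < p" and q: "q = p / (p - 1)"
  shows "\<exists>\<theta> B. 0 \<le> \<theta> \<and> \<theta> < 1 / (p + 1) \<and> (\<forall>y\<in>{0..<1}. \<exists>\<phi>. fooling_function p q \<theta> B y \<phi>)"
proof -
  \<comment> \<open>The constant used below the threshold \<open>a\<close> tends to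
    \<open>1 / p\<close> as \<open>a\<close> tends to 0. In the limit its two integrals are
    \<open>1 / p / 2\<close> and \<open>(1 / p) powr q\<close>, both strictly below
    \<open>1 / (p + 1)\<close>, so some positive \<open>a\<close> still keeps them there.\<close>
  have lim: "((\<lambda>a. 1 / (p * (1 - a))) \<longlongrightarrow> 1 / p) (at_right (0::real))"
    using p by (auto intro!: tendsto_eq_intros)
  have lim1: "((\<lambda>a. 1 / (p * (1 - a)) / 2) \<longlongrightarrow> 1 / p / 2) (at_right (0::real))"
    by (intro tendsto_intros lim) auto
  have lim2: "((\<lambda>a. (1 / (p * (1 - a))) powr q) \<longlongrightarrow> (1 / p) powr q) (at_right (0::real))"
    using p by (intro tendsto_intros lim) auto
  have "1 / p / 2 < 1 / (p + 1)" using p by (simp add: field_simps)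
  from order_tendstoD(2)[OF lim1 this]
  have 1: "eventually (\<lambda>a. 1 / (p * (1 - a)) / 2 < 1 / (p + 1)) (at_right (0::real))" .
  have "(1 / p) powr q < 1 / (p + 1)"
    unfolding q using p by (rule inverse_powr_conjugate_less)
  from order_tendstoD(2)[OF lim2 this]
  have 2: "eventually (\<lambda>a. (1 / (p * (1 - a))) powr q < 1 / (p + 1)) (at_right (0::real))" .
  have 3: "eventually (\<lambda>a. a \<in> {0<..<1}) (at_right (0::real))"
    by (rule eventually_at_right_real) simp
  from eventually_happens'[OF _ eventually_conj[OF 1 eventually_conj[OF 2 3]]]
  obtain a where a: "1 / (p * (1 - a)) / 2 < 1 / (p + 1)"
    "(1 / (p * (1 - a))) powr q < 1 / (p + 1)" "0 < a" "a < 1" by auto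
  \<comment> \<open>\<open>b\<close> is chosen so that \<open>b * (1 - a) = 1 / p\<close>: for every
    \<open>y\<close> up to \<open>a\<close> the constant \<open>b\<close> then has at least the
    potential of the extremal function at 0, which is its maximum.\<close>
  define b where "b = 1 / (p * (1 - a))"
  define \<theta> where "\<theta> = max (max (b / 2) (b powr q)) ((1 - a powr (p + 1)) / (p + 1))"
  have b: "0 < b" using a p by (simp add: b_def)
  have "0 \<le> \<theta>" using b by (auto simp: \<theta>_def le_max_iff_disj)
  moreover have "\<theta> < 1 / (p + 1)"
    using a p by (auto simp: \<theta>_def b_def[symmetric] divide_strict_right_mono)
  moreover have "\<exists>\<phi>. fooling_function p q \<theta> (max 1 b) y \<phi>"
    if y: "y \<in> {0..<1}" for y
  proof (cases "y < a")
    case True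
    let ?\<phi> = "\<lambda>t::real. b * indicator {0<..1} t"
    have "?\<phi> t * indicator {y<..} t = b * indicator {y<..1} t" for t
      using y by (auto simp: indicator_def)
    then have "(\<integral>t. ?\<phi> t * indicator {y<..} t \<partial>lborel) = (\<integral>t. b * indicator {y<..1} t \<partial>lborel)"
      by (intro Bochner_Integration.integral_cong refl)
    also have "\<dots> = b * (1 - y)"
      using y by simp
    finally have "(\<integral>t. ?\<phi> t * indicator {y<..} t \<partial>lborel) = b * (1 - y)" .
    moreover have "(1 - y powr p) / p \<le> b * (1 - y)"
    proof -
      have "(1 - y powr p) / p \<le> 1 / p" using p by (intro divide_right_mono) auto
      also have "1 / p = b * (1 - a)" using a by (simp add: b_def)
      also have "\<dots> \<le> b * (1 - y)" using b True by (intro mult_left_mono) auto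
      finally show ?thesis .
    qed
    moreover have "(\<integral>t. ?\<phi> t * t \<partial>lborel) = b / 2"
    proof -
      have "(\<integral>t. ?\<phi> t * t \<partial>lborel) = (\<integral>t. b * (t powr 1 * indicator {0<..1} t) \<partial>lborel)"
        by (intro Bochner_Integration.integral_cong refl) (auto simp: indicator_def)
      also have "\<dots> = b * (\<integral>t. t powr 1 * indicator {0<..1} t \<partial>lborel)"
        by (rule integral_mult_right_zero)
      also have "(\<integral>t. t powr 1 * indicator {0<..1} (t::real) \<partial>lborel) = 1 / 2"
        using has_bochner_integral_integral_eq[OF powr_integral[of 1 0]] by simp
      finally show ?thesis by simp
    qed
    moreover have "(\<integral>t. ?\<phi> t powr q \<partial>lborel) = b powr q"
    proof -
      have "?\<phi> t powr q = b powr q * indicator {0<..1} t" for t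
        by (auto simp: indicator_def)
      then show ?thesis by simp
    qed
    ultimately show ?thesis
      using b by (intro exI[of _ ?\<phi>]) (auto simp: fooling_function_def \<theta>_def indicator_def)
  next
    case False
    \<comment> \<open>For \<open>y\<close> at least \<open>a\<close> the truncation at
      \<open>y\<close> keeps the full potential at \<open>y\<close>, and its integrals lose at least
      the part below \<open>a\<close>.\<close>
    have "(1 - y powr (p + 1)) / (p + 1) \<le> (1 - a powr (p + 1)) / (p + 1)"
      using False a p by (intro divide_right_mono diff_left_mono powr_mono2) auto
    then have "(1 - y powr (p + 1)) / (p + 1) \<le> \<theta>" by (simp add: \<theta>_def)
    then show ?thesis
      using cutoff_power_bounds[of "p - 1" y] cutoff_power_integrals[of p y y q] y p q
      by (intro exI[of _ "cutoff_power (p - 1) y"]) (auto simp: fooling_function_def le_max_iff_disj)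
  qed
  ultimately show ?thesis by blast
qed

section \<open>Lower bound for the discrepancy of an arbitrary point set\<close>

text \<open>With \<open>c = (\<kappa> - \<theta>) / (1 + \<kappa>)\<close>, a weight
  \<open>w j\<close> at most 1 gives
  \<open>(1 + w j * \<kappa>) * c \<le> \<kappa> - \<theta>\<close>. Hence each factor on the left
  is at most \<open>(1 + w j * \<kappa>) * (1 - c * w j)\<close>, and
  \<open>1 - x \<le> exp (- x)\<close> does the rest.\<close>

lemma prod_weight_gap:
  fixes w :: "nat \<Rightarrow> real"
  assumes "0 \<le> \<theta>" "\<theta> \<le> \<kappa>" "\<And>j. j \<in> A \<Longrightarrow> 0 \<le> w j" "\<And>j. j \<in> A \<Longrightarrow> w j \<le> 1"
  shows "(\<Prod>j\<in>A. 1 + w j * \<theta>) \<le> (\<Prod>j\<in>A. 1 + w j * \<kappa>) * exp (- ((\<kappa> - \<theta>) / (1 + \<kappa>) * (\<Sum>j\<in>A. w j)))"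
\<comment> \<open>For infinite \<open>A\<close> the products default to 1 and the sum to 0, so both
  sides equal 1.\<close>
proof (cases "finite A")
  case True
  let ?c = "(\<kappa> - \<theta>) / (1 + \<kappa>)"
  have "1 + w j * \<theta> \<le> (1 + w j * \<kappa>) * exp (- (?c * w j))" if "j \<in> A" for j
  proof -
    have w: "0 \<le> w j" "w j \<le> 1" using assms that by auto
    have k: "0 \<le> \<kappa>" using assms by simp
    have "(1 + w j * \<kappa>) * (?c * w j) \<le> (1 + \<kappa>) * (?c * w j)"
      using w k assms by (intro mult_right_mono mult_nonneg_nonneg divide_nonneg_nonneg)
         (auto simp: mult_left_le_one_le)
    also have "\<dots> = w j * (\<kappa> - \<theta>)" using k by simp
    finally have "1 + w j * \<theta> \<le> (1 + w j * \<kappa>) * (1 + - (?c * w j))"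
      by (simp add: algebra_simps)
    also have "\<dots> \<le> (1 + w j * \<kappa>) * exp (- (?c * w j))"
      using w k by (intro mult_left_mono exp_ge_add_one_self) auto
    finally show ?thesis .
  qed
  then have "(\<Prod>j\<in>A. 1 + w j * \<theta>) \<le> (\<Prod>j\<in>A. (1 + w j * \<kappa>) * exp (- (?c * w j)))"
    using assms by (intro prod_mono) auto
  also have "\<dots> = (\<Prod>j\<in>A. 1 + w j * \<kappa>) * exp (- (?c * (\<Sum>j\<in>A. w j)))"
    using True by (simp add: prod.distrib exp_sum sum_distrib_left flip: sum_negf)
  finally show ?thesis .
qed auto

text \<open>Two applications of the duality bound are played against each other: the extremal
  function forces the points to carry much of its integral, the fooling functions forbid any single
  point to carry more than an exponentially small part. A bound \<open>M\<close> stands in for the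
  discrepancy because the normalization in Young's inequality needs a positive number.\<close>

lemma weighted_Lp_disc_lower_bound:
  fixes p :: real
  assumes p: "1 < p"
  shows "\<exists>c>0. \<forall>\<gamma> d P M. (\<forall>j\<in>{1..d}. 0 \<le> \<gamma> j \<and> \<gamma> j \<le> 1) \<longrightarrow> P \<subseteq> unit_cube d \<longrightarrow> finite P \<longrightarrow> P \<noteq> {} \<longrightarrow>
     0 < M \<longrightarrow> weighted_Lp_disc p \<gamma> d P \<le> M \<longrightarrow>
     initial_disc p \<gamma> d * (1 - card P * exp (- c * (\<Sum>j=1..d. \<gamma> j powr (p/2))))
       \<le> M * (1 + card P * exp (- c * (\<Sum>j=1..d. \<gamma> j powr (p/2))))"
proof -
  define q where "q = p / (p - 1)"
  have q: "1 < q" "1 / p + 1 / q = 1" using p by (auto simp: q_def field_simps)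
  define \<kappa> where "\<kappa> = 1 / (p + 1)"
  have \<kappa>: "0 < \<kappa>" using p by (simp add: \<kappa>_def)
  obtain \<theta> B where \<theta>: "0 \<le> \<theta>" "\<theta> < \<kappa>" and ex: "\<forall>y\<in>{0..<1}. \<exists>\<phi>. fooling_function p q \<theta> B y \<phi>"
    using exists_fooling_functions[OF p q_def] unfolding \<kappa>_def by blast
  from bchoice[OF ex] obtain F where "\<forall>y\<in>{0..<1}. fooling_function p q \<theta> B y (F y)" ..
  then have F: "F y \<in> borel_measurable borel" "0 \<le> F y t" "F y t \<le> B" "t \<notin> {0..1} \<Longrightarrow> F y t = 0"
     "(1 - y powr p) / p \<le> (\<integral>t. F y t * indicator {y<..} t \<partial>lborel)"
     "(\<integral>t. F y t * t \<partial>lborel) \<le> \<theta>" "(\<integral>t. F y t powr q \<partial>lborel) \<le> \<theta>"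
    if "y \<in> {0..<1}" for y t
    using that by (auto simp: fooling_function_def)
  \<comment> \<open>The gap between the products yields the rate
    \<open>(\<kappa> - \<theta>) / (1 + \<kappa>)\<close> for \<open>D\<close>. Dividing by
    \<open>q\<close> makes \<open>R\<close> small enough a loss that \<open>D powr (1 / q)\<close>
    also loses a factor \<open>R\<close>.\<close>
  define c where "c = (\<kappa> - \<theta>) / (1 + \<kappa>) / q"
  have c: "0 < c" using \<theta> \<kappa> q by (simp add: c_def)
  show ?thesis
  proof (intro exI[of _ c] conjI c allI impI)
    fix \<gamma> :: "nat \<Rightarrow> real" and d P M
    assume \<gamma>: "\<forall>j\<in>{1..d}. 0 \<le> \<gamma> j \<and> \<gamma> j \<le> 1" and P: "P \<subseteq> unit_cube d" "finite P" "P \<noteq> {}"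
      and M: "0 < M" "weighted_Lp_disc p \<gamma> d P \<le> M"
    define w where "w j = \<gamma> j powr (p/2)" for j
    define N where "N = real (card P)"
    define A where "A = (\<Prod>j=1..d. 1 + w j * \<kappa>)"
    define D where "D = (\<Prod>j=1..d. 1 + w j * \<theta>)"
    define R where "R = exp (- c * (\<Sum>j=1..d. w j))"
    define h where "h x = (\<Prod>j=1..d. 1 + w j * ((1 - x j powr p) / p))" for x
    have w: "0 \<le> w j" for j by (simp add: w_def)
    have w1: "w j \<le> 1" if "j \<in> {1..d}" for j using \<gamma> p that by (simp add: w_def powr_le1)
    have N: "0 < N" using P by (simp add: N_def card_gt_0_iff)
    have A: "1 \<le> A" unfolding A_def using w \<kappa> by (intro prod_ge_1) auto
    have D: "1 \<le> D" unfolding D_def using w \<theta> by (intro prod_ge_1) auto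
    have xP: "x j \<in> {0..<1}" if "x \<in> P" "j \<in> {1..d}" for x j
      using unit_cubeD[of x d j] P that by auto
    have R: "0 < R" "R \<le> 1" using c w by (auto simp: R_def intro!: mult_nonneg_nonneg sum_nonneg)
    have DA: "D \<le> A * R powr q"
    proof -
      have "D \<le> A * exp (- ((\<kappa> - \<theta>) / (1 + \<kappa>) * (\<Sum>j=1..d. w j)))"
        unfolding D_def A_def by (rule prod_weight_gap) (use \<theta> w w1 in auto)
      also have "exp (- ((\<kappa> - \<theta>) / (1 + \<kappa>) * (\<Sum>j=1..d. w j))) = R powr q"
        using q by (simp add: R_def c_def powr_def)
      finally show ?thesis .
    qed
    \<comment> \<open>First test, with the extremal function: \<open>h x\<close> is the product of
      its potentials, its integral is \<open>A\<close> and its q-norm is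
      \<open>A powr (1 / q)\<close>.\<close>
    have 1: "A - (\<Sum>x\<in>P. h x) / N \<le> M * A powr (1 / q)"
    proof -
      have "\<bar>(\<Sum>x\<in>P. \<Prod>j=1..d. 1 + w j * (\<integral>t. cutoff_power (p - 1) 0 t * indicator {x j<..} t \<partial>lborel)) / N
        - (\<Prod>j=1..d. 1 + w j * (\<integral>t. cutoff_power (p - 1) 0 t * t \<partial>lborel))\<bar>
        \<le> M * (\<Prod>j=1..d. 1 + w j * (\<integral>t. cutoff_power (p - 1) 0 t powr q \<partial>lborel)) powr (1 / q)"
        unfolding w_def N_def
        by (rule product_test_function_bound[where B=1])
           (use p q P M \<gamma> cutoff_power_bounds[of "p - 1" 0] in auto)
      also have "(\<Sum>x\<in>P. \<Prod>j=1..d. 1 + w j * (\<integral>t. cutoff_power (p - 1) 0 t * indicator {x j<..} t \<partial>lborel))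
        = (\<Sum>x\<in>P. h x)"
        unfolding h_def
      proof (intro sum.cong prod.cong refl)
        fix x j assume "x \<in> P" "j \<in> {1..d}"
        then show "1 + w j * (\<integral>t. cutoff_power (p - 1) 0 t * indicator {x j<..} t \<partial>lborel)
          = 1 + w j * ((1 - x j powr p) / p)"
          using xP[of x j] cutoff_power_integrals(1)[of p 0 "x j" q] p by (auto simp: q_def max_def)
      qed
      finally show ?thesis
        using cutoff_power_integrals(2,3)[of p 0 0 q] p by (simp add: A_def \<kappa>_def q_def abs_le_iff)
    qed
    \<comment> \<open>Second test, with the fooling functions adapted to \<open>x\<close>. All
      potentials and quadrature weights are nonnegative, so the other points may be dropped and the
      single term at \<open>x\<close> is bounded by integral plus error.\<close>
    have 2: "h x / N \<le> D + M * D powr (1 / q)" if x: "x \<in> P" for x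
    proof -
      \<comment> \<open>The duality bound asks for admissible functions at every index, so indices
        outside \<open>{1..d}\<close> receive the fooling function at the default point 0.\<close>
      define \<phi> where "\<phi> j = F (if j \<in> {1..d} then x j else 0)" for j
      have z: "(if j \<in> {1..d} then x j else 0) \<in> {0..<1}" for j using xP[OF x, of j] by auto
      note \<phi> = F[OF z, folded \<phi>_def]
      let ?H = "\<lambda>y. \<Prod>j=1..d. 1 + w j * (\<integral>t. \<phi> j t * indicator {y j<..} t \<partial>lborel)"
      have nonneg: "0 \<le> (\<integral>t. \<phi> j t * indicator {a<..} t \<partial>lborel)"
          "0 \<le> (\<integral>t. \<phi> j t * t \<partial>lborel)" "0 \<le> (\<integral>t. \<phi> j t powr q \<partial>lborel)" for a j
      proof -
        have "0 \<le> \<phi> j t * t" for t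
          using \<phi>(2,4) by (cases "t \<in> {0..1}") auto
        then show "0 \<le> (\<integral>t. \<phi> j t * t \<partial>lborel)"
          by (rule Bochner_Integration.integral_nonneg)
      qed (use \<phi>(2) in \<open>auto intro!: Bochner_Integration.integral_nonneg\<close>)
      have H0: "0 \<le> ?H y" for y using w nonneg by (intro prod_nonneg) auto
      have "h x \<le> ?H x"
        unfolding h_def
      proof (intro prod_mono conjI)
        fix j assume j: "j \<in> {1..d}"
        have "x j powr p \<le> 1" using xP[OF x j] p by (intro powr_le1) auto
        then show "0 \<le> 1 + w j * ((1 - x j powr p) / p)" using w p by simp
        show "1 + w j * ((1 - x j powr p) / p) \<le> 1 + w j * (\<integral>t. \<phi> j t * indicator {x j<..} t \<partial>lborel)"
          using \<phi>(5)[of j] j w by (intro add_left_mono mult_left_mono) auto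
      qed
      also have "\<dots> \<le> (\<Sum>y\<in>P. ?H y)"
        using P x H0 by (intro member_le_sum) auto
      finally have "h x / N \<le> (\<Sum>y\<in>P. ?H y) / N" using N by (intro divide_right_mono) auto
      also have "\<dots> \<le> (\<Prod>j=1..d. 1 + w j * (\<integral>t. \<phi> j t * t \<partial>lborel)) +
         M * (\<Prod>j=1..d. 1 + w j * (\<integral>t. \<phi> j t powr q \<partial>lborel)) powr (1 / q)"
      proof -
        have "\<bar>(\<Sum>y\<in>P. ?H y) / N - (\<Prod>j=1..d. 1 + w j * (\<integral>t. \<phi> j t * t \<partial>lborel))\<bar>
          \<le> M * (\<Prod>j=1..d. 1 + w j * (\<integral>t. \<phi> j t powr q \<partial>lborel)) powr (1 / q)"
          unfolding w_def N_def
          by (rule product_test_function_bound[where B=B]) (use p q P M \<gamma> \<phi> in auto)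
        then show ?thesis by linarith
      qed
      also have "\<dots> \<le> D + M * D powr (1 / q)"
        unfolding D_def using \<phi>(6,7) w nonneg M q
        by (intro add_mono mult_left_mono powr_mono2 prod_mono prod_nonneg conjI add_nonneg_nonneg
            mult_nonneg_nonneg) auto
      finally show ?thesis .
    qed
    have "(\<Sum>x\<in>P. h x) / N = (\<Sum>x\<in>P. h x / N)" by (simp add: sum_divide_distrib)
    also have "\<dots> \<le> (\<Sum>x\<in>P. D + M * D powr (1 / q))" by (intro sum_mono 2)
    also have "\<dots> = N * (D + M * D powr (1 / q))" by (simp add: N_def)
    \<comment> \<open>Both terms lose a factor \<open>R\<close>: the first since
      \<open>R powr q \<le> R\<close> for \<open>R \<le> 1\<close>, the second by taking the q-th
      root of \<open>DA\<close>.\<close>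
    also have "\<dots> \<le> N * (A * R + M * (A powr (1 / q) * R))"
    proof (intro mult_left_mono add_mono)
      have "R powr q \<le> R powr 1" using R q by (intro powr_mono') auto
      then have "A * R powr q \<le> A * R" using A R by (intro mult_left_mono) auto
      with DA show "D \<le> A * R" by linarith
      have "D powr (1 / q) \<le> (A * R powr q) powr (1 / q)"
        using DA D q by (intro powr_mono2) auto
      then show "D powr (1 / q) \<le> A powr (1 / q) * R"
        using R q A by (simp add: powr_mult powr_powr)
    qed (use N M in auto)
    finally have "A \<le> N * (A * R + M * (A powr (1 / q) * R)) + M * A powr (1 / q)" using 1 by linarith
    \<comment> \<open>Splitting \<open>A\<close> allows cancellation of
      \<open>A powr (1 / q)\<close>; what remains, \<open>A powr (1 / p)\<close>, is the initial
      discrepancy.\<close>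
    moreover have A2: "A = A powr (1 / p) * A powr (1 / q)"
      using A q by (simp flip: powr_add)
    ultimately have "A powr (1 / q) * (A powr (1 / p) * (1 - N * R)) \<le> A powr (1 / q) * (M * (1 + N * R))"
      by (simp add: algebra_simps)
    then have "A powr (1 / p) * (1 - N * R) \<le> M * (1 + N * R)"
      using A by (auto simp: mult_le_cancel_left)
    moreover have "initial_disc p \<gamma> d = A powr (1 / p)"
      by (simp add: initial_disc_def A_def \<kappa>_def w_def prod_powr_distrib)
    ultimately show "initial_disc p \<gamma> d * (1 - card P * exp (- c * (\<Sum>j=1..d. \<gamma> j powr (p/2))))
       \<le> M * (1 + card P * exp (- c * (\<Sum>j=1..d. \<gamma> j powr (p/2))))"
      by (simp add: N_def R_def w_def)
  qed
qed

section \<open>Regular grids: every accuracy is reached by some number of points\<close>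

definition grid :: "nat \<Rightarrow> nat \<Rightarrow> (nat \<Rightarrow> real) set" where
  "grid d m = (\<Pi>\<^sub>E j\<in>{1..d}. (\<lambda>k. real k / real m) ` {..<m})"

lemma grid_subset_finite_card:
  assumes "0 < m"
  shows "grid d m \<subseteq> unit_cube d" "finite (grid d m)" "card (grid d m) = m ^ d"
proof -
  have "(\<lambda>k. real k / real m) ` {..<m} \<subseteq> {0..<1}" using assms by auto
  then show "grid d m \<subseteq> unit_cube d" unfolding grid_def unit_cube_def by (intro PiE_mono)
  show "finite (grid d m)" unfolding grid_def by (intro finite_PiE) auto
  have "inj_on (\<lambda>k. real k / real m) {..<m}" using assms by (auto simp: inj_on_def)
  then show "card (grid d m) = m ^ d" by (simp add: grid_def card_PiE card_image)
qed

text \<open>\<open>k / m < s\<close> means \<open>k < m * s\<close>, and the naturals below a real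
  are counted by its ceiling; \<open>s \<le> 1\<close> keeps the count within the \<open>m\<close>
  available values.\<close>

lemma card_grid_below:
  assumes "0 < m" "0 \<le> s" "s \<le> 1"
  shows "card {y \<in> (\<lambda>k. real k / real m) ` {..<m}. y \<in> {0..<s}} = nat \<lceil>real m * s\<rceil>"
proof -
  have "{y \<in> (\<lambda>k. real k / real m) ` {..<m}. y \<in> {0..<s}}
    = (\<lambda>k. real k / real m) ` {..<nat \<lceil>real m * s\<rceil>}" (is "?A = ?B")
  proof (intro equalityI subsetI)
    fix y assume "y \<in> ?A"
    then obtain k where k: "y = real k / real m" "y < s" by auto
    then have "real m * y < real m * s" using assms by (intro mult_strict_left_mono) auto
    then have "real k < real m * s" using k assms by simp
    then have "k < nat \<lceil>real m * s\<rceil>" by linarith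
    then show "y \<in> ?B" using k by auto
  next
    fix y assume "y \<in> ?B"
    then obtain k where k: "y = real k / real m" "k < nat \<lceil>real m * s\<rceil>" by auto
    then have "real k < real m * s" by linarith
    moreover from this have "real k < real m"
      using mult_left_le[of s "real m"] assms by linarith
    ultimately show "y \<in> ?A" using k assms by (auto simp: pos_divide_less_eq mult.commute)
  qed
  moreover have "inj_on (\<lambda>k. real k / real m) {..<nat \<lceil>real m * s\<rceil>}"
    using assms by (auto simp: inj_on_def)
  ultimately show ?thesis by (simp add: card_image)
qed

text \<open>In each coordinate the fraction of grid values below \<open>s j\<close> differs from
  \<open>s j\<close> by at most \<open>1 / m\<close>. Products of numbers in \<open>[0,1]\<close>
  differ by at most the sum of the differences of their factors.\<close>

lemma local_disc_grid:
  assumes m: "0 < m" and s: "\<And>j. j \<in> {1..d} \<Longrightarrow> s j \<in> {0..1}"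
  shows "\<bar>local_disc d (grid d m) s\<bar> \<le> real d / real m"
proof -
  let ?c = "\<lambda>j. nat \<lceil>real m * s j\<rceil>"
  have "{x \<in> grid d m. \<forall>j\<in>{1..d}. x j \<in> {0..<s j}}
      = (\<Pi>\<^sub>E j\<in>{1..d}. {y \<in> (\<lambda>k. real k / real m) ` {..<m}. y \<in> {0..<s j}})"
    by (auto simp: grid_def PiE_iff extensional_def)
  then have "card {x \<in> grid d m. \<forall>j\<in>{1..d}. x j \<in> {0..<s j}}
      = (\<Prod>j=1..d. card {y \<in> (\<lambda>k. real k / real m) ` {..<m}. y \<in> {0..<s j}})"
    by (simp only: card_PiE finite_atLeastAtMost)
  also have "\<dots> = (\<Prod>j=1..d. ?c j)"
    by (intro prod.cong card_grid_below refl) (use m s in \<open>force+\<close>)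
  finally have "local_disc d (grid d m) s = (\<Prod>j=1..d. real (?c j) / real m) - (\<Prod>j=1..d. s j)"
    using grid_subset_finite_card(3)[OF m, of d]
    by (simp add: local_disc_def prod_dividef)
  also have "\<bar>\<dots>\<bar> \<le> (\<Sum>j=1..d. \<bar>real (?c j) / real m - s j\<bar>)"
  proof -
    have "norm ((\<Prod>j=1..d. real (?c j) / real m) - (\<Prod>j=1..d. s j))
      \<le> (\<Sum>j=1..d. norm (real (?c j) / real m - s j))"
    proof (rule norm_prod_diff)
      fix j assume j: "j \<in> {1..d}"
      have "real m * s j \<le> real m" using s[OF j] m by (simp add: mult_left_le)
      then have "?c j \<le> m" by linarith
      then show "norm (real (?c j) / real m) \<le> 1" using m by simp
      show "norm (s j) \<le> 1" using s[OF j] by simp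
    qed
    then show ?thesis by simp
  qed
  also have "\<dots> \<le> (\<Sum>j=1..d. 1 / real m)"
  proof (rule sum_mono)
    fix j assume j: "j \<in> {1..d}"
    have "0 \<le> real m * s j" using s[OF j] by simp
    then have "\<bar>real (?c j) - real m * s j\<bar> \<le> 1" by linarith
    then have "\<bar>real (?c j) - real m * s j\<bar> / real m \<le> 1 / real m" by (rule divide_right_mono) simp
    moreover have "real (?c j) / real m - s j = (real (?c j) - real m * s j) / real m"
      using m by (simp add: field_simps)
    ultimately show "\<bar>real (?c j) / real m - s j\<bar> \<le> 1 / real m" by simp
  qed
  finally show ?thesis by simp
qed

text \<open>There are at most \<open>2 ^ d\<close> faces, each with weight at most 1 and integral at
  most \<open>(d / m) powr p\<close>.\<close>

lemma weighted_Lp_disc_grid: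
  assumes m: "0 < m" and p: "0 < p" and \<gamma>: "\<And>j. j \<in> {1..d} \<Longrightarrow> 0 \<le> \<gamma> j \<and> \<gamma> j \<le> 1"
  shows "weighted_Lp_disc p \<gamma> d (grid d m) \<le> (2 ^ d) powr (1 / p) * (real d / real m)"
proof -
  let ?b = "(real d / real m) powr p"
  let ?I = "\<lambda>u. LINT t:(\<Pi>\<^sub>E j\<in>u. {0..1})|(\<Pi>\<^sub>M j\<in>u. lborel).
      \<bar>local_disc d (grid d m) (fill_one u t)\<bar> powr p"
  have I: "?I u \<le> ?b" "0 \<le> ?I u" if "u \<subseteq> {1..d}" for u
  proof -
    have fu: "finite u" using that finite_subset by blast
    have "?I u \<le> (LINT t|(\<Pi>\<^sub>M j\<in>u. lborel). indicator (\<Pi>\<^sub>E j\<in>u. {0..1::real}) t * ?b)"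
      unfolding set_lebesgue_integral_def
    proof (rule integral_mono')
      show "integrable (\<Pi>\<^sub>M j\<in>u. lborel) (\<lambda>t. indicator (\<Pi>\<^sub>E (j::nat)\<in>u. {0..1::real}) t * ?b)"
        using unit_box_integrable(1)[OF fu] by simp
      fix t :: "nat \<Rightarrow> real"
      have "\<bar>local_disc d (grid d m) (fill_one u t)\<bar> powr p \<le> ?b" if "t \<in> (\<Pi>\<^sub>E j\<in>u. {0..1})"
        using p that by (intro powr_mono2 local_disc_grid m) (auto simp: fill_one_def PiE_iff)
      then show "indicat_real (\<Pi>\<^sub>E j\<in>u. {0..1}) t *\<^sub>R \<bar>local_disc d (grid d m) (fill_one u t)\<bar> powr p
        \<le> indicator (\<Pi>\<^sub>E j\<in>u. {0..1}) t * ?b"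
        by (auto simp: indicator_def)
    qed auto
    also have "\<dots> = ?b" using unit_box_integrable(2)[OF fu] by simp
    finally show "?I u \<le> ?b" .
    show "0 \<le> ?I u"
      unfolding set_lebesgue_integral_def by (rule Bochner_Integration.integral_nonneg) simp
  qed
  have "(\<Sum>u\<in>Pow {1..d} - {{}}. (\<Prod>j\<in>u. \<gamma> j) powr (p / 2) * ?I u) \<le> (\<Sum>u\<in>Pow {1..d} - {{}}. 1 * ?b)"
  proof (intro sum_mono mult_mono)
    fix u assume "u \<in> Pow {1..d} - {{}}"
    then have u: "u \<subseteq> {1..d}" by simp
    then have "0 \<le> (\<Prod>j\<in>u. \<gamma> j)" "(\<Prod>j\<in>u. \<gamma> j) \<le> 1"
      using \<gamma> by (blast intro: prod_nonneg, blast intro: prod_le_1)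
    then show "(\<Prod>j\<in>u. \<gamma> j) powr (p / 2) \<le> 1" using p by (intro powr_le1) auto
    show "?I u \<le> ?b" "0 \<le> ?I u" using I[OF u] by auto
  qed simp
  also have "\<dots> \<le> (\<Sum>u\<in>Pow {1..d}. 1 * ?b)" by (rule sum_mono2) auto
  also have "\<dots> = 2 ^ d * ?b" by (simp add: card_Pow)
  finally have "weighted_Lp_disc p \<gamma> d (grid d m) \<le> (2 ^ d * ?b) powr (1 / p)"
    unfolding weighted_Lp_disc_def using p I
    by (intro powr_mono2) (auto intro!: sum_nonneg mult_nonneg_nonneg)
  also have "\<dots> = (2 ^ d) powr (1 / p) * (real d / real m)"
    using p by (simp add: powr_mult powr_powr)
  finally show ?thesis .
qed

lemma disc_le:
  assumes "P \<subseteq> unit_cube d" "finite P"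
  shows "disc p \<gamma> (card P) d \<le> weighted_Lp_disc p \<gamma> d P"
  unfolding disc_def
proof (rule cINF_lower)
  show "bdd_below (weighted_Lp_disc p \<gamma> d ` {Q. Q \<subseteq> unit_cube d \<and> finite Q \<and> card Q = card P})"
    by (rule bdd_belowI[of _ 0]) (auto simp: weighted_Lp_disc_def)
qed (use assms in auto)

lemma initial_disc_ge_1:
  assumes "0 < p"
  shows "1 \<le> initial_disc p \<gamma> d"
  unfolding initial_disc_def using assms by (intro prod_ge_1 ge_one_powr_ge_zero) auto

text \<open>This makes the minimum in \<open>N_disc\<close> genuine: only when a suitable
  \<open>N\<close> exists does \<open>LEAST\<close> satisfy its defining condition. A fine enough
  grid supplies one.\<close>

lemma disc_le_exists:
  assumes p: "0 < p" and \<gamma>: "\<And>j. j \<in> {1..d} \<Longrightarrow> 0 \<le> \<gamma> j \<and> \<gamma> j \<le> 1" and "0 < \<epsilon>"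
  shows "\<exists>N\<ge>1. disc p \<gamma> N d \<le> \<epsilon> * initial_disc p \<gamma> d"
proof -
  obtain m0 where m0: "(2 ^ d) powr (1 / p) * real d / \<epsilon> \<le> real m0" using real_arch_simple by blast
  define m where "m = Suc m0"
  have m: "0 < m" "(2 ^ d) powr (1 / p) * real d \<le> \<epsilon> * real m"
    using m0 \<open>0 < \<epsilon>\<close> by (auto simp: m_def field_simps)
  have "disc p \<gamma> (m ^ d) d \<le> weighted_Lp_disc p \<gamma> d (grid d m)"
    using disc_le[of "grid d m" d p \<gamma>] grid_subset_finite_card[OF m(1), of d] by simp
  also have "\<dots> \<le> (2 ^ d) powr (1 / p) * (real d / real m)"
    by (rule weighted_Lp_disc_grid) (use m p \<gamma> in auto)
  also have "\<dots> \<le> \<epsilon> * 1" using m by (simp add: field_simps)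
  also have "\<dots> \<le> \<epsilon> * initial_disc p \<gamma> d"
    using initial_disc_ge_1[OF p] \<open>0 < \<epsilon>\<close> by (intro mult_left_mono) auto
  finally show ?thesis using m by (intro exI[of _ "m ^ d"]) auto
qed

section \<open>Exponential lower bound for the number of points at accuracy one half\<close>

text \<open>Guarantees point sets of every size, so that the infimum in \<open>disc\<close> runs
  over a nonempty family.\<close>

lemma infinite_unit_cube:
  assumes "1 \<le> d"
  shows "infinite (unit_cube d)"
proof
  assume "finite (unit_cube d)"
  then have "finite ((\<lambda>x. x 1) ` unit_cube d)" by (rule finite_imageI)
  moreover have "{0..<1} \<subseteq> (\<lambda>x. x 1) ` unit_cube d"
  proof
    fix y :: real assume "y \<in> {0..<1}"
    then have "restrict (\<lambda>_. y) {1..d} \<in> unit_cube d" by (auto simp: unit_cube_def)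
    then show "y \<in> (\<lambda>x. x 1) ` unit_cube d" using assms by (rule_tac image_eqI) auto
  qed
  ultimately have "finite {0..<1::real}" using finite_subset by blast
  then show False by (simp add: infinite_Ico)
qed

lemma N_disc_half_lower_bound:
  fixes p :: real
  assumes p: "1 < p"
  shows "\<exists>c>0. \<forall>\<gamma> d. (\<forall>j\<in>{1..d}. 0 \<le> \<gamma> j \<and> \<gamma> j \<le> 1) \<longrightarrow> 1 \<le> d \<longrightarrow>
     exp (c * (\<Sum>j=1..d. \<gamma> j powr (p/2))) / 4 \<le> real (N_disc p \<gamma> (1/2) d)"
proof -
  obtain c where c: "0 < c" and low: "\<And>\<gamma> d P M. \<lbrakk>\<forall>j\<in>{1..d}. 0 \<le> \<gamma> j \<and> \<gamma> j \<le> 1; P \<subseteq> unit_cube d;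
       finite P; P \<noteq> {}; 0 < M; weighted_Lp_disc p \<gamma> d P \<le> M\<rbrakk> \<Longrightarrow>
     initial_disc p \<gamma> d * (1 - card P * exp (- c * (\<Sum>j=1..d. \<gamma> j powr (p/2))))
       \<le> M * (1 + card P * exp (- c * (\<Sum>j=1..d. \<gamma> j powr (p/2))))"
    using weighted_Lp_disc_lower_bound[OF p] by blast
  show ?thesis
  proof (intro exI[of _ c] conjI c allI impI)
    fix \<gamma> :: "nat \<Rightarrow> real" and d :: nat
    assume \<gamma>: "\<forall>j\<in>{1..d}. 0 \<le> \<gamma> j \<and> \<gamma> j \<le> 1" and d: "1 \<le> d"
    define I where "I = initial_disc p \<gamma> d"
    define N where "N = N_disc p \<gamma> (1/2) d"
    define S where "S = c * (\<Sum>j=1..d. \<gamma> j powr (p/2))"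
    have I: "1 \<le> I" unfolding I_def by (rule initial_disc_ge_1) (use p in simp)
    have "\<exists>N. 1 \<le> N \<and> disc p \<gamma> N d \<le> 1/2 * initial_disc p \<gamma> d"
      using disc_le_exists[of p d \<gamma> "1/2"] p \<gamma> by auto
    from LeastI_ex[OF this] have N: "1 \<le> N" "disc p \<gamma> N d \<le> 1/2 * I"
      unfolding N_def N_disc_def I_def by auto
    \<comment> \<open>The infimum need not be attained, so a point set slightly above
      \<open>1/2 * I\<close> is chosen. With \<open>3/5\<close> the lower bound becomes
      \<open>2/5 \<le> 8/5 * N * exp (- S)\<close>, which gives the factor
      \<open>1 / 4\<close>.\<close>
    have "disc p \<gamma> N d < 3/5 * I" using N I by linarith
    moreover have "{P. P \<subseteq> unit_cube d \<and> finite P \<and> card P = N} \<noteq> {}"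
      using infinite_arbitrarily_large[OF infinite_unit_cube[OF d], of N] by blast
    ultimately have "\<exists>y\<in>weighted_Lp_disc p \<gamma> d ` {P. P \<subseteq> unit_cube d \<and> finite P \<and> card P = N}. y < 3/5 * I"
      unfolding disc_def by (intro cInf_lessD) (simp_all only: image_is_empty not_False_eq_True)
    then obtain P where P: "P \<subseteq> unit_cube d" "finite P" "card P = N"
        "weighted_Lp_disc p \<gamma> d P < 3/5 * I"
      by blast
    have "P \<noteq> {}" using P N by auto
    have "I * (1 - N * exp (- S)) \<le> 3/5 * I * (1 + N * exp (- S))"
      using low[OF \<gamma> P(1,2) \<open>P \<noteq> {}\<close>, of "3/5 * I"] P N I by (auto simp: I_def S_def)
    then have "I * (1 - N * exp (- S)) \<le> I * (3/5 * (1 + N * exp (- S)))" by (simp add: algebra_simps)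
    then have "1 - N * exp (- S) \<le> 3/5 * (1 + N * exp (- S))" using I by simp
    then have "1 / 4 \<le> N * exp (- S)" by (simp add: field_simps)
    then have "1 / 4 * exp S \<le> N * exp (- S) * exp S" by (intro mult_right_mono) auto
    then show "exp (c * (\<Sum>j=1..d. \<gamma> j powr (p/2))) / 4 \<le> real (N_disc p \<gamma> (1/2) d)"
      by (simp add: S_def N_def mult.assoc flip: exp_add)
  qed
qed

text \<open>The logarithmic form of the previous bound. Positivity of \<open>N_disc\<close> is
  recorded too, since its logarithm is later compared with that of upper bounds.\<close>

lemma ln_N_disc_half_lower_bound:
  fixes p :: real
  assumes p: "1 < p" and \<gamma>: "\<forall>j\<ge>1. 0 < \<gamma> j \<and> \<gamma> j \<le> 1"
  shows "\<exists>c>0. \<forall>d\<ge>1. 1 \<le> N_disc p \<gamma> (1/2) d \<and>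
     (\<Sum>j=1..d. \<gamma> j powr (p/2)) \<le> (ln (real (N_disc p \<gamma> (1/2) d)) + ln 4) / c"
proof -
  obtain c where c: "0 < c" and low: "\<And>\<gamma> d. \<lbrakk>\<forall>j\<in>{1..d}. 0 \<le> \<gamma> j \<and> \<gamma> j \<le> 1; 1 \<le> d\<rbrakk> \<Longrightarrow>
     exp (c * (\<Sum>j=1..d. \<gamma> j powr (p/2))) / 4 \<le> real (N_disc p \<gamma> (1/2) d)"
    using N_disc_half_lower_bound[OF p] by blast
  show ?thesis
  proof (intro exI[of _ c] conjI c allI impI)
    fix d :: nat assume d: "1 \<le> d"
    have le: "exp (c * (\<Sum>j=1..d. \<gamma> j powr (p/2))) / 4 \<le> real (N_disc p \<gamma> (1/2) d)"
      using low[OF _ d, of \<gamma>] \<gamma> by (simp add: less_imp_le)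
    then have "0 < real (N_disc p \<gamma> (1/2) d)" by (rule less_le_trans[rotated]) simp
    then show "1 \<le> N_disc p \<gamma> (1/2) d" by simp
    have "ln (exp (c * (\<Sum>j=1..d. \<gamma> j powr (p/2))) / 4) \<le> ln (real (N_disc p \<gamma> (1/2) d))"
      using le by (intro ln_mono) auto
    then have "c * (\<Sum>j=1..d. \<gamma> j powr (p/2)) \<le> ln (real (N_disc p \<gamma> (1/2) d)) + ln 4"
      by (simp add: ln_div)
    then show "(\<Sum>j=1..d. \<gamma> j powr (p/2)) \<le> (ln (real (N_disc p \<gamma> (1/2) d)) + ln 4) / c"
      using c by (simp add: pos_le_divide_eq mult.commute)
  qed
qed

section \<open>Consequences of tractability, read off at accuracy one half\<close>

text \<open>The joint limit is restricted to the line \<open>\<epsilon> = 1/2\<close>, where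
  \<open>d + 1 / \<epsilon>\<close> equals \<open>d + 2\<close> and tends to infinity with
  \<open>d\<close>.\<close>

lemma weakly_tractable_imp_half:
  assumes "weakly_tractable p \<gamma>"
  shows "(\<lambda>d. ln (real (N_disc p \<gamma> (1/2) d)) / (real d + 2)) \<longlonglongrightarrow> 0"
proof -
  let ?F = "inf (filtercomap (\<lambda>(\<epsilon>::real, d::nat). real d + 1 / \<epsilon>) at_top)
            (principal ({0<..<1} \<times> {1..}))"
  have "filterlim (\<lambda>d::nat. real d + 2) at_top sequentially"
    by real_asymp
  then have "filterlim (\<lambda>d. (1/2::real, d)) ?F sequentially"
    unfolding filterlim_inf filterlim_filtercomap_iff filterlim_principal
    by (auto simp: o_def eventually_at_top_linorder intro!: exI[of _ 1])
  from filterlim_compose[OF assms[unfolded weakly_tractable_def] this]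
  show ?thesis by simp
qed

text \<open>Dividing by \<open>d\<close> or by \<open>d + 2\<close> makes no difference in the
  limit. \<open>N\<close> is an arbitrary sequence here: it stands for \<open>ln\<close> of
  \<open>N_disc\<close> under weak tractability and for a multiple of \<open>ln d\<close> under
  polynomial tractability.\<close>

lemma average_tendsto_0:
  fixes S N :: "nat \<Rightarrow> real"
  assumes "0 < c" "\<And>d. 0 \<le> S d" "\<forall>d\<ge>1. S d \<le> (N d + b) / c"
    and "(\<lambda>d. N d / (real d + 2)) \<longlonglongrightarrow> 0"
  shows "(\<lambda>d. 1 / real d * S d) \<longlonglongrightarrow> 0"
proof (rule tendsto_sandwich[OF _ _ tendsto_const])
  have 1: "(\<lambda>d. 1 / real d) \<longlonglongrightarrow> 0" by (rule lim_1_over_n)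
  have "(\<lambda>d. (N d / (real d + 2) * (1 + 2 * (1 / real d)) + b * (1 / real d)) / c) \<longlonglongrightarrow> (0 * (1 + 2 * 0) + b * 0) / c"
    by (intro tendsto_intros assms 1) (use assms in auto)
  then show "(\<lambda>d. (N d / (real d + 2) * (1 + 2 * (1 / real d)) + b * (1 / real d)) / c) \<longlonglongrightarrow> 0"
    by simp
  show "\<forall>\<^sub>F d in sequentially. 1 / real d * S d
      \<le> (N d / (real d + 2) * (1 + 2 * (1 / real d)) + b * (1 / real d)) / c"
    using eventually_ge_at_top[of 1]
  proof eventually_elim
    fix d :: nat assume d: "1 \<le> d"
    have "1 / real d * S d \<le> 1 / real d * ((N d + b) / c)"
      using assms(3) d by (intro mult_left_mono) auto
    also have "N d / (real d + 2) * (1 + 2 * (1 / real d)) = N d / real d"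
    proof -
      have "1 + 2 * (1 / real d) = (real d + 2) / real d" using d by (simp add: field_simps)
      then show ?thesis using d by simp
    qed
    then have "1 / real d * ((N d + b) / c)
      = (N d / (real d + 2) * (1 + 2 * (1 / real d)) + b * (1 / real d)) / c"
      by (simp add: add_divide_distrib mult.commute)
    finally show "1 / real d * S d
      \<le> (N d / (real d + 2) * (1 + 2 * (1 / real d)) + b * (1 / real d)) / c" .
  qed
qed (use assms in auto)

text \<open>If the limit \<open>L\<close> were positive, all late terms would exceed
  \<open>L / 2\<close> and the averages could not fall below about \<open>(L / 2) powr r\<close>.
  Convergence is assumed because vanishing averages still leave room for sparse large
  weights.\<close>

lemma convergent_average_tendsto_0:
  fixes \<gamma> :: "nat \<Rightarrow> real"
  assumes r: "0 < r" and \<gamma>: "\<And>j. 1 \<le> j \<Longrightarrow> 0 < \<gamma> j" and "convergent \<gamma>"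
    and avg: "(\<lambda>d. 1 / real d * (\<Sum>j=1..d. \<gamma> j powr r)) \<longlonglongrightarrow> 0"
  shows "\<gamma> \<longlonglongrightarrow> 0"
proof -
  obtain L where L: "\<gamma> \<longlonglongrightarrow> L" using \<open>convergent \<gamma>\<close> by (auto simp: convergent_def)
  have "0 \<le> L"
    by (rule LIMSEQ_le_const[OF L]) (use \<gamma> in \<open>auto intro!: exI[of _ 1] less_imp_le\<close>)
  moreover have "\<not> 0 < L"
  proof
    assume "0 < L"
    then have "\<forall>\<^sub>F j in sequentially. L / 2 < \<gamma> j" by (intro order_tendstoD(1)[OF L]) simp
    then obtain n where n: "\<And>j. n \<le> j \<Longrightarrow> L / 2 < \<gamma> j" by (auto simp: eventually_sequentially)
    define k where "k = (L / 2) powr r"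
    have k: "0 < k" using \<open>0 < L\<close> by (simp add: k_def)
    \<comment> \<open>Discarding the first \<open>n\<close> terms costs at most
      \<open>k * n / d\<close> in the average, which vanishes in the limit.\<close>
    have "(\<lambda>d. k - k * real n * (1 / real d)) \<longlonglongrightarrow> k - k * real n * 0"
      by (intro tendsto_intros lim_1_over_n)
    moreover have "\<exists>m. \<forall>d\<ge>m. k - k * real n * (1 / real d) \<le> 1 / real d * (\<Sum>j=1..d. \<gamma> j powr r)"
    proof (intro exI allI impI)
      fix d assume d: "Suc n \<le> d"
      have "k * (real d - real n) = (\<Sum>j\<in>{Suc n..d}. k)" using d by (simp add: of_nat_diff)
      also have "\<dots> \<le> (\<Sum>j\<in>{Suc n..d}. \<gamma> j powr r)"
        unfolding k_def using n r \<open>0 < L\<close> by (intro sum_mono powr_mono2) (auto intro: less_imp_le)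
      also have "\<dots> \<le> (\<Sum>j=1..d. \<gamma> j powr r)" by (rule sum_mono2) auto
      finally have "1 / real d * (k * (real d - real n)) \<le> 1 / real d * (\<Sum>j=1..d. \<gamma> j powr r)"
        by (rule mult_left_mono) simp
      then show "k - k * real n * (1 / real d) \<le> 1 / real d * (\<Sum>j=1..d. \<gamma> j powr r)"
        using d by (simp add: right_diff_distrib diff_divide_distrib)
    qed
    ultimately have "k - k * real n * 0 \<le> 0" by (rule LIMSEQ_le[OF _ avg])
    with k show False by simp
  qed
  ultimately show ?thesis using L by simp
qed

text \<open>At \<open>\<epsilon> = 1/2\<close> the accuracy contributes only a constant, so
  logarithms leave a constant plus a multiple of \<open>ln d\<close>. The exponent
  \<open>\<tau>\<close> stays a parameter: \<open>\<tau> = 0\<close> is the strong case.\<close>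

lemma polynomially_tractable_sum_bound:
  fixes p :: real
  assumes p: "1 < p" and \<gamma>: "\<forall>j\<ge>1. 0 < \<gamma> j \<and> \<gamma> j \<le> 1" and "0 < C"
    and N: "\<forall>\<epsilon>\<in>{0<..<1}. \<forall>d\<ge>1. real (N_disc p \<gamma> \<epsilon> d) \<le> C * real d powr \<tau> * \<epsilon> powr (- \<sigma>)"
  shows "\<exists>c K. 0 < c \<and> (\<forall>d\<ge>1. (\<Sum>j=1..d. \<gamma> j powr (p/2)) \<le> K + \<tau> / c * ln (real d))"
proof -
  obtain c where c0: "0 < c \<and> (\<forall>d\<ge>1. 1 \<le> N_disc p \<gamma> (1/2) d \<and>
     (\<Sum>j=1..d. \<gamma> j powr (p/2)) \<le> (ln (real (N_disc p \<gamma> (1/2) d)) + ln 4) / c)"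
    using ln_N_disc_half_lower_bound[OF p \<gamma>] ..
  then have c: "0 < c" "\<And>d. 1 \<le> d \<Longrightarrow> 1 \<le> N_disc p \<gamma> (1/2) d"
     "\<And>d. 1 \<le> d \<Longrightarrow> (\<Sum>j=1..d. \<gamma> j powr (p/2)) \<le> (ln (real (N_disc p \<gamma> (1/2) d)) + ln 4) / c"
    by blast+
  define K where "K = (ln C + ln ((1/2) powr (- \<sigma>)) + ln 4) / c"
  show ?thesis
  proof (rule exI[of _ c], rule exI[of _ K], intro conjI allI impI)
    fix d :: nat assume d: "1 \<le> d"
    have "ln (real (N_disc p \<gamma> (1/2) d)) \<le> ln (C * real d powr \<tau> * (1/2) powr (- \<sigma>))"
      using c(2)[OF d] bspec[OF N, of "1/2"] d by (intro ln_mono) auto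
    also have "\<dots> = ln C + \<tau> * ln (real d) + ln ((1/2) powr (- \<sigma>))"
      using \<open>0 < C\<close> d by (simp add: ln_mult ln_powr)
    finally have "(ln (real (N_disc p \<gamma> (1/2) d)) + ln 4) / c
        \<le> (ln C + \<tau> * ln (real d) + ln ((1/2) powr (- \<sigma>)) + ln 4) / c"
      using c by (intro divide_right_mono) auto
    also have "\<dots> = K + \<tau> / c * ln (real d)" by (simp only: K_def add_divide_distrib times_divide_eq_left ac_simps)
    finally show "(\<Sum>j=1..d. \<gamma> j powr (p/2)) \<le> K + \<tau> / c * ln (real d)"
      using c(3)[OF d] by linarith
  qed (rule c)
qed

theorem theorem1:
  fixes p :: real and \<gamma> :: "nat \<Rightarrow> real"
  assumes "1 < p"
    and "\<And>j. 1 \<le> j \<Longrightarrow> 0 < \<gamma> j \<and> \<gamma> j \<le> 1"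
  shows "(convergent \<gamma> \<longrightarrow>
           weakly_tractable p \<gamma> \<or> polynomially_tractable p \<gamma> \<or> strongly_polynomially_tractable p \<gamma> \<longrightarrow>
           \<gamma> \<longlonglongrightarrow> 0) \<and>
         (strongly_polynomially_tractable p \<gamma> \<longrightarrow> \<gamma> \<longlonglongrightarrow> 0) \<and>
         (strongly_polynomially_tractable p \<gamma> \<longrightarrow> summable (\<lambda>j. \<gamma> (Suc j) powr (p / 2))) \<and>
         (polynomially_tractable p \<gamma> \<longrightarrow>
           limsup (\<lambda>d. ereal (1 / ln (real d) * (\<Sum>j=1..d. \<gamma> j powr (p / 2)))) < \<infinity>) \<and>
         (weakly_tractable p \<gamma> \<longrightarrow>
           (\<lambda>d. 1 / real d * (\<Sum>j=1..d. \<gamma> j powr (p / 2))) \<longlonglongrightarrow> 0)"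
proof -
  let ?S = "\<lambda>d. \<Sum>j=1..d. \<gamma> j powr (p / 2)"
  have S: "0 \<le> ?S d" for d by (intro sum_nonneg) simp
  have \<gamma>: "\<forall>j\<ge>1. 0 < \<gamma> j \<and> \<gamma> j \<le> 1" using assms(2) by blast
  have weak: "(\<lambda>d. 1 / real d * ?S d) \<longlonglongrightarrow> 0" if w: "weakly_tractable p \<gamma>"
  proof -
    obtain c where c: "0 < c \<and> (\<forall>d\<ge>1. 1 \<le> N_disc p \<gamma> (1/2) d \<and>
       ?S d \<le> (ln (real (N_disc p \<gamma> (1/2) d)) + ln 4) / c)"
      using ln_N_disc_half_lower_bound[OF \<open>1 < p\<close> \<gamma>] ..
    then have le: "\<forall>d\<ge>1. ?S d \<le> (ln (real (N_disc p \<gamma> (1/2) d)) + ln 4) / c" by blast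
    show ?thesis
      by (rule average_tendsto_0[OF _ S le weakly_tractable_imp_half[OF w]]) (use c in blast)
  qed
  have poly: "\<exists>c K \<tau>. 0 < c \<and> 0 \<le> \<tau> \<and> (\<forall>d\<ge>1. ?S d \<le> K + \<tau> / c * ln (real d))"
    if "polynomially_tractable p \<gamma>"
  proof -
    obtain C \<sigma> \<tau> where C: "0 < C" "0 \<le> \<tau>" and N: "\<forall>\<epsilon>\<in>{0<..<1}. \<forall>d\<ge>1.
        real (N_disc p \<gamma> \<epsilon> d) \<le> C * real d powr \<tau> * \<epsilon> powr (- \<sigma>)"
      using \<open>polynomially_tractable p \<gamma>\<close> unfolding polynomially_tractable_def by auto
    then show ?thesis using polynomially_tractable_sum_bound[OF \<open>1 < p\<close> \<gamma> C(1) N] by blast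
  qed
  \<comment> \<open>Logarithmic growth of the sums is slower than linear, so polynomial tractability
    also forces the averages to vanish; this feeds the limit claim for convergent weights.\<close>
  have poly_avg: "(\<lambda>d. 1 / real d * ?S d) \<longlonglongrightarrow> 0" if po: "polynomially_tractable p \<gamma>"
  proof -
    obtain c K \<tau> where K: "0 < c" "0 \<le> \<tau>" "\<And>d. 1 \<le> d \<Longrightarrow> ?S d \<le> K + \<tau> / c * ln (real d)"
      using poly[OF po] by blast
    have ln_lim: "(\<lambda>d. \<tau> / c * (ln (real d) / real d) * (real d / (real d + 2))) \<longlonglongrightarrow> \<tau> / c * 0 * 1"
    proof (intro tendsto_intros lim_ln_over_n)
      show "(\<lambda>d. real d / (real d + 2)) \<longlonglongrightarrow> 1" by real_asymp
    qed
    have "(\<lambda>d. \<tau> / c * ln (real d) / (real d + 2)) \<longlonglongrightarrow> 0"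
      by (rule Lim_transform_eventually[OF ln_lim[simplified]])
        (auto intro!: eventually_sequentiallyI[of 1])
    then show ?thesis
      using K(3) by (intro average_tendsto_0[of 1 _ "\<lambda>d. \<tau> / c * ln (real d)" K] S) (auto simp: add.commute)
  qed
  have strong: "summable (\<lambda>j. \<gamma> (Suc j) powr (p / 2))" if st: "strongly_polynomially_tractable p \<gamma>"
  proof -
    obtain C \<sigma> where C: "0 < C" and N: "\<forall>\<epsilon>\<in>{0<..<1}. \<forall>d\<ge>1.
        real (N_disc p \<gamma> \<epsilon> d) \<le> C * \<epsilon> powr (- \<sigma>)"
      using st unfolding strongly_polynomially_tractable_def by auto
    have N0: "\<forall>\<epsilon>\<in>{0<..<1}. \<forall>d\<ge>1. real (N_disc p \<gamma> \<epsilon> d) \<le> C * real d powr 0 * \<epsilon> powr (- \<sigma>)"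
      using N by simp
    obtain c K where "\<forall>d\<ge>1. ?S d \<le> K + 0 / c * ln (real d)"
      using polynomially_tractable_sum_bound[OF \<open>1 < p\<close> \<gamma> C N0] by blast
    then have K: "?S d \<le> K" if "1 \<le> d" for d using that by simp
    show ?thesis
    proof (rule summableI_nonneg_bounded)
      \<comment> \<open>The maximum with 0 covers the empty sum \<open>n = 0\<close>, since the
        bound \<open>K\<close> is available only from dimension 1 on.\<close>
      show "(\<Sum>j<n. \<gamma> (Suc j) powr (p / 2)) \<le> max 0 K" for n
        using K[of n] by (cases n) (auto simp: sum.atLeast1_atMost_eq le_max_iff_disj)
    qed simp
  qed
  have strong_lim: "\<gamma> \<longlonglongrightarrow> 0" if st: "strongly_polynomially_tractable p \<gamma>"
  proof -
    \<comment> \<open>Terms of a convergent series tend to 0, and the power \<open>2 / p\<close>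
      undoes \<open>p / 2\<close>. Strong tractability thus gives the limit without assuming
      convergence.\<close>
    have "(\<lambda>j. (\<gamma> (Suc j) powr (p / 2)) powr (2 / p)) \<longlonglongrightarrow> 0"
      by (rule tendsto_zero_powrI[OF summable_LIMSEQ_zero[OF strong[OF st]] tendsto_const])
        (use \<open>1 < p\<close> in auto)
    moreover have "(\<gamma> (Suc j) powr (p / 2)) powr (2 / p) = \<gamma> (Suc j)" for j
      using assms(2)[of "Suc j"] \<open>1 < p\<close> by (simp add: powr_powr)
    ultimately have "(\<lambda>j. \<gamma> (Suc j)) \<longlonglongrightarrow> 0" by simp
    then show ?thesis by (simp add: filterlim_sequentially_Suc)
  qed
  have avg_lim: "\<gamma> \<longlonglongrightarrow> 0" if "convergent \<gamma>" "(\<lambda>d. 1 / real d * ?S d) \<longlonglongrightarrow> 0"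
    by (rule convergent_average_tendsto_0[of "p / 2"]) (use assms that in auto)
  have limsup: "limsup (\<lambda>d. ereal (1 / ln (real d) * ?S d)) < \<infinity>"
    if po: "polynomially_tractable p \<gamma>"
  proof -
    obtain c K \<tau> where K: "0 < c" "0 \<le> \<tau>" "\<And>d. 1 \<le> d \<Longrightarrow> ?S d \<le> K + \<tau> / c * ln (real d)"
      using poly[OF po] by blast
    have "limsup (\<lambda>d. ereal (1 / ln (real d) * ?S d)) \<le> ereal (\<bar>K\<bar> + \<tau> / c)"
    \<comment> \<open>From \<open>d = 3\<close> on, \<open>ln d\<close> is at least 1, so the
      constant \<open>K\<close>, whose sign is unknown, is absorbed into
      \<open>\<bar>K\<bar> * ln d\<close>.\<close>
    proof (rule Limsup_bounded, rule eventually_sequentiallyI[of 3])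
      fix d :: nat assume d: "3 \<le> d"
      have "exp 1 \<le> real d" using exp_le d by linarith
      then have l: "1 \<le> ln (real d)" using d by (subst ln_ge_iff) auto
      have "?S d \<le> \<bar>K\<bar> * ln (real d) + \<tau> / c * ln (real d)"
        using K(3)[of d] d mult_left_mono[OF l, of "\<bar>K\<bar>"] by simp
      then have "?S d \<le> (\<bar>K\<bar> + \<tau> / c) * ln (real d)" by (simp add: distrib_right)
      then have "1 / ln (real d) * ?S d \<le> \<bar>K\<bar> + \<tau> / c" using l by (simp add: pos_divide_le_eq)
      then show "ereal (1 / ln (real d) * ?S d) \<le> ereal (\<bar>K\<bar> + \<tau> / c)" by simp
    qed
    then show ?thesis by (rule le_less_trans) simp
  qed
  show ?thesis
    using weak poly_avg strong strong_lim avg_lim limsup by blast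
qed

end
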